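(* Let $C\subset\mathbb{R}^3$ be a closed vertex-free curve. If no sphere has contact of order $4$ (or higher) with $C$ at any point, then $$\int_C\omega=\left|\int_C T(t)\,\mathrm{d}t\right|\ge 2\pi,$$ where $T$ (which is nowhere zero) is the conformal torsion of $C$, $t$ denotes the conformal arc-length of $C$, and $\omega=|T|\,\mathrm{d}t$.
   Context: Curves are smooth and regular. Spheres and circles are understood in the sense of conformal (Möbius) geometry, so planes count as spheres and lines as circles. A curve has contact of order $\ge k$ with a sphere at a point if, for a local smooth defining function $F$ of the sphere (with nonvanishing differential), the restriction of $F$ to the curve and its first $k$ derivatives vanish at that point; contact with a circle is defined similarly (contact of order $\ge k$ with two distinct spheres whose intersection is the circle). A point is a vertex of a curve if the osculating circle there has contact of order at least $3$ with the curve; a curve is vertex-free if it has no vertices. Let $u$ be the Euclidean arc-length of $C$, and $k(u),\tau(u)$ its curvature and torsion, primes denoting derivatives with respect to $u$. Vertices are the points where $k'^2+k^2\tau^2=0$. On a vertex-free curve the conformal arc-length $t$ is defined by $$\mathrm{d}t=\sqrt[4]{k'^2+k^2\tau^2}\,\mathrm{d}u,$$ and the conformal torsion is $$T=\frac{2k'^2\tau+k^2\tau^3+kk'\tau'-kk''\tau}{(k'^2+k^2\tau^2)^{5/4}}.$$ Both $\mathrm{d}t$ and $T$ are invariant under Möbius transformations (at a point where $k=0$ they are defined by first applying a Möbius transformation making the curvature nonzero there). The 1-form $\omega=|T|\,\mathrm{d}t$ is also the pull-back to $C$ of the arc-length element of the curve $\sigma$ of osculating spheres (the spheres with contact of order $\ge3$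 with $C$), where the set of oriented spheres of $\mathbb{R}^3\cup\{\infty\}\cong\mathbb{S}^3$ is identified with de Sitter space $\Lambda^4=\{x\in\mathbb{R}^5:\langle x,x\rangle=1\}$, $\langle x,y\rangle=x_1y_1+x_2y_2+x_3y_3+x_4y_4-x_5y_5$, with its induced Lorentz metric. *)

theory Defs
  imports "HOL-Analysis.Analysis"
begin

section \<open>Smooth maps and closed curves\<close>

primrec C_diff_on :: "nat \<Rightarrow> ('a::real_normed_vector \<Rightarrow> 'b::real_normed_vector) \<Rightarrow> 'a set \<Rightarrow> bool" where
  "C_diff_on 0 f U \<longleftrightarrow> continuous_on U f"
| "C_diff_on (Suc n) f U \<longleftrightarrow>
     (\<forall>x\<in>U. f differentiable (at x)) \<and> (\<forall>v. C_diff_on n (\<lambda>x. frechet_derivative f (at x) v) U)"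

definition smooth_on :: "('a::real_normed_vector \<Rightarrow> 'b::real_normed_vector) \<Rightarrow> 'a set \<Rightarrow> bool" where
  "smooth_on f U \<longleftrightarrow> (\<forall>n. C_diff_on n f U)"

text \<open>A closed curve is given by a smooth regular periodic parametrization, not necessarily by
  arc-length; \<open>{0..L}\<close> runs through the curve once. Self-intersections are allowed.\<close>

definition closed_curve :: "(real \<Rightarrow> real^3) \<Rightarrow> real \<Rightarrow> bool" where
  "closed_curve \<gamma> L \<longleftrightarrow> L > 0 \<and> smooth_on \<gamma> UNIV \<and>
     (\<forall>s. vector_derivative \<gamma> (at s) \<noteq> 0) \<and> (\<forall>s. \<gamma> (s + L) = \<gamma> s)"


section \<open>Spheres, circles and contact\<close>

text \<open>The finite parts of the spheres and circles of conformal geometry: planes are the spheres,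
  and lines the circles, through the point at infinity.\<close>

definition moebius_sphere :: "(real^3) set \<Rightarrow> bool" where
  "moebius_sphere S \<longleftrightarrow> (\<exists>a r. r > 0 \<and> S = sphere a r) \<or> (\<exists>n d. n \<noteq> 0 \<and> S = {x. n \<bullet> x = d})"

definition moebius_circle :: "(real^3) set \<Rightarrow> bool" where
  "moebius_circle \<Gamma> \<longleftrightarrow>
     (\<exists>a r n. r > 0 \<and> n \<noteq> 0 \<and> \<Gamma> = {x \<in> sphere a r. n \<bullet> (x - a) = 0}) \<or>
     (\<exists>p v. v \<noteq> 0 \<and> \<Gamma> = range (\<lambda>c. p + c *\<^sub>R v))"

definition local_defining_function ::
    "(real^3 \<Rightarrow> real) \<Rightarrow> (real^3) set \<Rightarrow> (real^3) set \<Rightarrow> bool" where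
  "local_defining_function F U S \<longleftrightarrow> open U \<and> smooth_on F U \<and> S \<inter> U = {x \<in> U. F x = 0} \<and>
     (\<forall>x \<in> S \<inter> U. frechet_derivative F (at x) \<noteq> (\<lambda>v. 0))"

text \<open>\<open>contact_sphere k \<gamma> s S\<close>: at parameter \<open>s\<close>, the curve \<open>\<gamma>\<close> has contact of order at least \<open>k\<close>
  with \<open>S\<close>.\<close>

definition contact_sphere :: "nat \<Rightarrow> (real \<Rightarrow> real^3) \<Rightarrow> real \<Rightarrow> (real^3) set \<Rightarrow> bool" where
  "contact_sphere k \<gamma> s S \<longleftrightarrow>
     (\<exists>F U. \<gamma> s \<in> U \<and> local_defining_function F U S \<and> (\<forall>j\<le>k. (deriv ^^ j) (F \<circ> \<gamma>) s = 0))"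

definition contact_circle :: "nat \<Rightarrow> (real \<Rightarrow> real^3) \<Rightarrow> real \<Rightarrow> (real^3) set \<Rightarrow> bool" where
  "contact_circle k \<gamma> s \<Gamma> \<longleftrightarrow>
     (\<exists>S1 S2. moebius_sphere S1 \<and> moebius_sphere S2 \<and> S1 \<noteq> S2 \<and> S1 \<inter> S2 = \<Gamma> \<and>
        contact_sphere k \<gamma> s S1 \<and> contact_sphere k \<gamma> s S2)"

definition osculating_circle :: "(real \<Rightarrow> real^3) \<Rightarrow> real \<Rightarrow> (real^3) set \<Rightarrow> bool" where
  "osculating_circle \<gamma> s \<Gamma> \<longleftrightarrow> moebius_circle \<Gamma> \<and> contact_circle 2 \<gamma> s \<Gamma>"

definition is_vertex :: "(real \<Rightarrow> real^3) \<Rightarrow> real \<Rightarrow> bool" where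
  "is_vertex \<gamma> s \<longleftrightarrow> (\<exists>\<Gamma>. osculating_circle \<gamma> s \<Gamma> \<and> contact_circle 3 \<gamma> s \<Gamma>)"

definition vertex_free :: "(real \<Rightarrow> real^3) \<Rightarrow> bool" where
  "vertex_free \<gamma> \<longleftrightarrow> (\<forall>s. \<not> is_vertex \<gamma> s)"


section \<open>Curvature and torsion\<close>

text \<open>Derivative along \<open>\<gamma>\<close> with respect to its Euclidean arc-length \<open>u\<close>, where
  \<open>du = \<parallel>\<gamma>'(s)\<parallel> ds\<close>.\<close>

definition arc_deriv ::
    "(real \<Rightarrow> real^3) \<Rightarrow> (real \<Rightarrow> 'b::real_normed_vector) \<Rightarrow> real \<Rightarrow> 'b" where
  "arc_deriv \<gamma> f s = vector_derivative f (at s) /\<^sub>R norm (vector_derivative \<gamma> (at s))"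

definition unit_tangent :: "(real \<Rightarrow> real^3) \<Rightarrow> real \<Rightarrow> real^3" where
  "unit_tangent \<gamma> = arc_deriv \<gamma> \<gamma>"

definition curvature :: "(real \<Rightarrow> real^3) \<Rightarrow> real \<Rightarrow> real" where
  "curvature \<gamma> s = norm (arc_deriv \<gamma> (unit_tangent \<gamma>) s)"

definition principal_normal :: "(real \<Rightarrow> real^3) \<Rightarrow> real \<Rightarrow> real^3" where
  "principal_normal \<gamma> s = arc_deriv \<gamma> (unit_tangent \<gamma>) s /\<^sub>R curvature \<gamma> s"

definition binormal :: "(real \<Rightarrow> real^3) \<Rightarrow> real \<Rightarrow> real^3" where
  "binormal \<gamma> s = cross3 (unit_tangent \<gamma> s) (principal_normal \<gamma> s)"

definition torsion :: "(real \<Rightarrow> real^3) \<Rightarrow> real \<Rightarrow> real" where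
  "torsion \<gamma> s = - (arc_deriv \<gamma> (binormal \<gamma>) s \<bullet> principal_normal \<gamma> s)"


section \<open>Conformal arc-length and conformal torsion\<close>

text \<open>The Euclidean formulas, meaningful where the curvature is nonzero. The first one is
  \<open>dt/ds\<close>, the density of the conformal arc-length with respect to the given parameter.\<close>

definition euclidean_conformal_speed :: "(real \<Rightarrow> real^3) \<Rightarrow> real \<Rightarrow> real" where
  "euclidean_conformal_speed \<gamma> s =
     (let k = curvature \<gamma> s; \<tau> = torsion \<gamma> s; k' = arc_deriv \<gamma> (curvature \<gamma>) s
      in root 4 (k'\<^sup>2 + k\<^sup>2 * \<tau>\<^sup>2) * norm (vector_derivative \<gamma> (at s)))"

definition euclidean_conformal_torsion :: "(real \<Rightarrow> real^3) \<Rightarrow> real \<Rightarrow> real" where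
  "euclidean_conformal_torsion \<gamma> s =
     (let k = curvature \<gamma> s; \<tau> = torsion \<gamma> s;
          k' = arc_deriv \<gamma> (curvature \<gamma>) s; \<tau>' = arc_deriv \<gamma> (torsion \<gamma>) s;
          k'' = arc_deriv \<gamma> (arc_deriv \<gamma> (curvature \<gamma>)) s
      in (2 * k'\<^sup>2 * \<tau> + k\<^sup>2 * \<tau>^3 + k * k' * \<tau>' - k * k'' * \<tau>)
         / (k'\<^sup>2 + k\<^sup>2 * \<tau>\<^sup>2) powr (5/4))"

text \<open>Orientation-preserving Moebius transformations of \<open>\<real>\<^sup>3 \<union> {\<infinity>}\<close> sending \<open>p\<close> to a finite point
  (an orientation-reversing one would change the sign of the conformal torsion). Every such
  transformation is a direct similarity, or an inversion with centre \<open>a \<noteq> p\<close> followed by an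
  orientation-reversing similarity.\<close>

definition moebius_at :: "real^3 \<Rightarrow> (real^3 \<Rightarrow> real^3) \<Rightarrow> bool" where
  "moebius_at p \<phi> \<longleftrightarrow>
     (\<exists>a b c (A :: real^3^3). c > 0 \<and> orthogonal_matrix A \<and>
        (det A = 1 \<and> \<phi> = (\<lambda>x. b + c *\<^sub>R (A *v (x - a))) \<or>
         det A = -1 \<and> a \<noteq> p \<and> \<phi> = (\<lambda>x. b + (c / (norm (x - a))\<^sup>2) *\<^sub>R (A *v (x - a)))))"

text \<open>At a point of zero curvature the conformal quantities are those of the image under any
  such transformation making the curvature nonzero there; by Moebius invariance they do not
  depend on the choice.\<close>

definition normalized_curve :: "(real \<Rightarrow> real^3) \<Rightarrow> real \<Rightarrow> real \<Rightarrow> real^3" where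
  "normalized_curve \<gamma> s =
     (if curvature \<gamma> s \<noteq> 0 then \<gamma>
      else (SOME \<phi>. moebius_at (\<gamma> s) \<phi> \<and> curvature (\<phi> \<circ> \<gamma>) s \<noteq> 0) \<circ> \<gamma>)"

definition conformal_speed :: "(real \<Rightarrow> real^3) \<Rightarrow> real \<Rightarrow> real" where
  "conformal_speed \<gamma> s = euclidean_conformal_speed (normalized_curve \<gamma> s) s"

definition conformal_torsion :: "(real \<Rightarrow> real^3) \<Rightarrow> real \<Rightarrow> real" where
  "conformal_torsion \<gamma> s = euclidean_conformal_torsion (normalized_curve \<gamma> s) s"

end

theory Submission
  imports Defs
begin

text \<open>Let \<open>t\<close> be the unit tangent, \<open>K\<close> the curvature vector and \<open>W\<close> the normal part of its arc-length
  derivative. The conformal torsion form is the rotation rate of \<open>W\<close> in the normal bundle, with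
  numerator \<open>det (t, W, W')\<close>, and this determinant vanishes exactly where some sphere has contact of
  order four. In the Lorentz model the osculating sphere \<open>\<sigma>\<close>, parametrized by the integral of
  \<open>\<bar>T\<bar> dt\<close>, satisfies \<open>\<sigma>'' + \<sigma> = \<mu>\<close> where \<open>\<mu>\<close> is a null vector proportional to the curve point,
  always in the same half cone. A closed solution of period \<open>l < 2 pi\<close> cannot exist: pairing the
  equation with kernel \<open>x sin x\<close>, which is nonnegative on \<open>{- pi..pi}\<close>, gives a contradiction.\<close>

section \<open>Smooth functions of a real variable\<close>

text \<open>The curvature may vanish, and there the Frenet frame and the Euclidean formulas break
  down. The frame used is therefore t, W / |W| and their cross product, which exists wherever det
  (t, W, W') is nonzero; the Frenet frame serves only to identify the formulas where K is nonzero.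
  At a zero of K its derivative is W, so such points are isolated and the integrals do not see them.
  At those points the torsion is shown to be nonzero by transporting contact, not the value of T,
  through the Moebius map. The constant 2 pi comes from the self-adjoint operator f'' + f on
  functions of period l. For l < 2 pi it is invertible, and there is a periodic B with B'' + B = 2
  sin (l/2) \<sigma>. Pairing B with \<mu> = \<sigma>'' + \<sigma> and integrating gives 2 sin (l/2)
  l > 0, because \<sigma> has unit length. Pointwise, however, the pairing is nonpositive: up to a
  multiple of cos x, the kernel expressing B through \<mu> is a multiple of x sin x, and the cos x
  part only reproduces a multiple of \<sigma>, which is orthogonal to \<mu> at the same
  point.\<close>

lemma C_diff_on_cong:
  assumes "open U" "\<And>x. x \<in> U \<Longrightarrow> f x = g x" "C_diff_on n f U"
  shows "C_diff_on n g U"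
  using assms(2,3)
proof (induction n arbitrary: f g)
  case 0
  then show ?case by (simp cong: continuous_on_cong)
next
  case (Suc n)
  have *: "(g has_derivative frechet_derivative f (at x)) (at x)" if "x \<in> U" for x
    using has_derivative_transform_within_open[OF _ \<open>open U\<close> that Suc.prems(1)]
      Suc.prems(2) that frechet_derivative_works by fastforce
  have eq: "frechet_derivative f (at x) = frechet_derivative g (at x)" if "x \<in> U" for x
    using frechet_derivative_at[OF *[OF that]] .
  have "C_diff_on n (\<lambda>x. frechet_derivative g (at x) v) U" for v
    by (rule Suc.IH[of "\<lambda>x. frechet_derivative f (at x) v"]) (use eq Suc.prems(2) in auto)
  then show ?case using * by (auto simp: differentiable_def)
qed

lemma C_diff_on_bounded_linear:
  assumes "bounded_linear h" "open U" "C_diff_on n f U"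
  shows "C_diff_on n (\<lambda>x. h (f x)) U"
  using assms(3)
proof (induction n arbitrary: f)
  case 0
  then show ?case by (simp add: bounded_linear.continuous_on[OF assms(1)])
next
  case (Suc n)
  have *: "((\<lambda>x. h (f x)) has_derivative (\<lambda>v. h (frechet_derivative f (at x) v))) (at x)"
    if "x \<in> U" for x
    using Suc.prems that bounded_linear.has_derivative[OF assms(1)] frechet_derivative_works by fastforce
  have eq: "h (frechet_derivative f (at x) v) = frechet_derivative (\<lambda>x. h (f x)) (at x) v"
    if "x \<in> U" for x v
    using frechet_derivative_at[OF *[OF that]] by metis
  have "C_diff_on n (\<lambda>x. frechet_derivative (\<lambda>x. h (f x)) (at x) v) U" for v
    by (rule C_diff_on_cong[OF \<open>open U\<close> eq Suc.IH]) (use Suc.prems in auto)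
  then show ?case using * by (auto simp: differentiable_def)
qed

lemma frechet_derivative_real:
  fixes f :: "real \<Rightarrow> 'a::real_normed_vector"
  assumes "f differentiable (at x)"
  shows "frechet_derivative f (at x) v = v *\<^sub>R vector_derivative f (at x)"
proof -
  have "(f has_derivative (\<lambda>v. v *\<^sub>R vector_derivative f (at x))) (at x)"
    using assms vector_derivative_works unfolding has_vector_derivative_def by blast
  from frechet_derivative_at[OF this] show ?thesis by metis
qed

text \<open>A direction in the real line is a scalar, so every directional derivative is a multiple
  of the one in direction 1.\<close>

lemma C_diff_on_real_Suc:
  fixes f :: "real \<Rightarrow> 'a::real_normed_vector"
  assumes "open U"
  shows "C_diff_on (Suc n) f U \<longleftrightarrow>
    (\<forall>x\<in>U. f differentiable (at x)) \<and> C_diff_on n (\<lambda>x. vector_derivative f (at x)) U"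
proof (cases "\<forall>x\<in>U. f differentiable (at x)")
  case True
  have "C_diff_on n (\<lambda>x. frechet_derivative f (at x) v) U"
    if "C_diff_on n (\<lambda>x. vector_derivative f (at x)) U" for v
    by (rule C_diff_on_cong[OF assms _ C_diff_on_bounded_linear[OF bounded_linear_scaleR_right[of v] assms that]])
       (use True in \<open>simp add: frechet_derivative_real\<close>)
  moreover have "C_diff_on n (\<lambda>x. vector_derivative f (at x)) U"
    if "C_diff_on n (\<lambda>x. frechet_derivative f (at x) 1) U"
    by (rule C_diff_on_cong[OF assms _ that]) (use True in \<open>simp add: frechet_derivative_real\<close>)
  ultimately show ?thesis using True by auto
qed (simp, blast)

declare C_diff_on.simps(2) [simp del]

lemma C_diff_on_real_SucI:
  fixes f :: "real \<Rightarrow> 'a::real_normed_vector"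
  assumes "open U" "\<And>x. x \<in> U \<Longrightarrow> (f has_vector_derivative f' x) (at x)" "C_diff_on n f' U"
  shows "C_diff_on (Suc n) f U"
  unfolding C_diff_on_real_Suc[OF assms(1)]
proof
  show "\<forall>x\<in>U. f differentiable (at x)" using assms(2) by (auto simp: has_vector_derivative_def differentiable_def)
  show "C_diff_on n (\<lambda>x. vector_derivative f (at x)) U"
    by (rule C_diff_on_cong[OF assms(1) _ assms(3)]) (metis assms(2) vector_derivative_at)
qed

lemma C_diff_on_real_SucD:
  fixes f :: "real \<Rightarrow> 'a::real_normed_vector"
  assumes "open U" "C_diff_on (Suc n) f U"
  shows "\<And>x. x \<in> U \<Longrightarrow> (f has_vector_derivative vector_derivative f (at x)) (at x)"
    and "C_diff_on n (\<lambda>x. vector_derivative f (at x)) U"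
  using assms by (auto simp: C_diff_on_real_Suc vector_derivative_works)

lemma C_diff_on_real_lower:
  fixes f :: "real \<Rightarrow> 'a::real_normed_vector"
  assumes "open U" "C_diff_on (Suc n) f U"
  shows "C_diff_on n f U"
  using assms(2)
proof (induction n arbitrary: f)
  case 0
  then show ?case
    using C_diff_on_real_SucD(1)[OF assms(1) 0]
    by (auto intro!: continuous_at_imp_continuous_on has_vector_derivative_continuous)
next
  case (Suc n)
  show ?case
    by (rule C_diff_on_real_SucI[OF assms(1) _ Suc.IH])
       (fact C_diff_on_real_SucD[OF assms(1) Suc.prems])+
qed

lemma C_diff_on_real_const:
  assumes "open (U::real set)" shows "C_diff_on n (\<lambda>x. c) U"
proof (induction n arbitrary: c)
  case (Suc n)
  then show ?case by (intro C_diff_on_real_SucI[OF assms, where f' = "\<lambda>_. 0"]) auto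
qed simp

lemma C_diff_on_real_add:
  fixes f g :: "real \<Rightarrow> 'a::real_normed_vector"
  assumes "open U" "C_diff_on n f U" "C_diff_on n g U"
  shows "C_diff_on n (\<lambda>x. f x + g x) U"
  using assms(2,3)
proof (induction n arbitrary: f g)
  case (Suc n)
  note f = C_diff_on_real_SucD[OF assms(1) Suc.prems(1)] and g = C_diff_on_real_SucD[OF assms(1) Suc.prems(2)]
  show ?case
    by (rule C_diff_on_real_SucI[OF assms(1) _ Suc.IH[OF f(2) g(2)]]) (intro has_vector_derivative_add f g)
qed (simp add: continuous_on_add)

lemma C_diff_on_real_bilinear:
  fixes f :: "real \<Rightarrow> 'a::real_normed_vector" and g :: "real \<Rightarrow> 'b::real_normed_vector"
  assumes "bounded_bilinear h" "open U" "C_diff_on n f U" "C_diff_on n g U"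
  shows "C_diff_on n (\<lambda>x. h (f x) (g x)) U"
  using assms(3,4)
proof (induction n arbitrary: f g)
  case 0
  then show ?case by (simp add: bounded_bilinear.continuous_on[OF assms(1)])
next
  case (Suc n)
  note f = C_diff_on_real_SucD[OF assms(2) Suc.prems(1)] and g = C_diff_on_real_SucD[OF assms(2) Suc.prems(2)]
  show ?case
    by (rule C_diff_on_real_SucI[OF assms(2) _ C_diff_on_real_add[OF assms(2) Suc.IH Suc.IH]])
       (use f g Suc.prems bounded_bilinear.has_vector_derivative[OF assms(1)] C_diff_on_real_lower[OF assms(2)] in blast)+
qed

text \<open>The derivative is a product of f' with copies of 1/f itself, so the induction runs over
  the order alone with \<open>f\<close> fixed. The square root below works in the same way.\<close>

lemma C_diff_on_real_inverse:
  fixes f :: "real \<Rightarrow> real"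
  assumes "open U" "\<And>x. x \<in> U \<Longrightarrow> f x \<noteq> 0" "C_diff_on n f U"
  shows "C_diff_on n (\<lambda>x. inverse (f x)) U"
  using assms(3)
proof (induction n)
  case 0
  then show ?case using assms(2) by (simp add: continuous_on_inverse)
next
  case (Suc n)
  note f = C_diff_on_real_SucD[OF assms(1) Suc.prems]
  have IH: "C_diff_on n (\<lambda>x. inverse (f x)) U"
    by (rule Suc.IH) (rule C_diff_on_real_lower[OF assms(1) Suc.prems])
  note mult = C_diff_on_real_bilinear[OF bounded_bilinear_mult assms(1)]
  have "((\<lambda>x. inverse (f x)) has_vector_derivative
      -1 * (vector_derivative f (at x) * (inverse (f x) * inverse (f x)))) (at x)" if "x \<in> U" for x
    using DERIV_inverse_fun[of f "vector_derivative f (at x)" x UNIV] f(1)[OF that] assms(2)[OF that]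
    by (simp add: has_real_derivative_iff_has_vector_derivative mult_ac)
  then show ?case
    by (rule C_diff_on_real_SucI[OF assms(1) _ mult[OF C_diff_on_real_const[OF assms(1)] mult[OF f(2) mult[OF IH IH]]]])
qed

lemma C_diff_on_real_sqrt:
  fixes f :: "real \<Rightarrow> real"
  assumes "open U" "\<And>x. x \<in> U \<Longrightarrow> f x > 0" "C_diff_on n f U"
  shows "C_diff_on n (\<lambda>x. sqrt (f x)) U"
  using assms(3)
proof (induction n)
  case 0
  then show ?case by (simp add: continuous_on_real_sqrt)
next
  case (Suc n)
  note f = C_diff_on_real_SucD[OF assms(1) Suc.prems]
  have IH: "C_diff_on n (\<lambda>x. sqrt (f x)) U"
    by (rule Suc.IH) (rule C_diff_on_real_lower[OF assms(1) Suc.prems])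
  note mult = C_diff_on_real_bilinear[OF bounded_bilinear_mult assms(1)]
  have pos: "sqrt (f x) \<noteq> 0" if "x \<in> U" for x
    using assms(2)[OF that] by simp
  have "((\<lambda>x. sqrt (f x)) has_vector_derivative
      1/2 * (vector_derivative f (at x) * inverse (sqrt (f x)))) (at x)" if "x \<in> U" for x
    using DERIV_chain2[OF DERIV_real_sqrt[OF assms(2)[OF that]]
        f(1)[OF that, folded has_real_derivative_iff_has_vector_derivative]]
    unfolding has_real_derivative_iff_has_vector_derivative[symmetric] by (simp add: mult_ac)
  then show ?case
    by (rule C_diff_on_real_SucI[OF assms(1) _ mult[OF C_diff_on_real_const[OF assms(1)]
          mult[OF f(2) C_diff_on_real_inverse[OF assms(1) pos IH]]]])
qed

lemma smooth_on_subset: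
  assumes "smooth_on f U" "V \<subseteq> U"
  shows "smooth_on f V"
proof -
  have "C_diff_on n f U \<Longrightarrow> C_diff_on n f V" for n
    using assms(2) by (induction n arbitrary: f) (auto simp: C_diff_on.simps intro: continuous_on_subset)
  then show ?thesis using assms(1) by (simp add: smooth_on_def)
qed

lemma smooth_on_has_vector_derivative:
  fixes f :: "real \<Rightarrow> 'a::real_normed_vector"
  assumes "open U" "smooth_on f U" "x \<in> U"
  shows "(f has_vector_derivative vector_derivative f (at x)) (at x)"
  using assms C_diff_on_real_SucD(1) unfolding smooth_on_def by blast

lemma smooth_on_vector_derivative:
  fixes f :: "real \<Rightarrow> 'a::real_normed_vector"
  assumes "open U" "smooth_on f U"
  shows "smooth_on (\<lambda>x. vector_derivative f (at x)) U"
  using assms C_diff_on_real_SucD(2) unfolding smooth_on_def by blast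

lemma smooth_on_continuous:
  "smooth_on f U \<Longrightarrow> continuous_on U f"
  unfolding smooth_on_def by (metis C_diff_on.simps(1))

lemma smooth_on_real_const: "open (U::real set) \<Longrightarrow> smooth_on (\<lambda>x. c) U"
  by (simp add: smooth_on_def C_diff_on_real_const)

lemma smooth_on_real_add:
  fixes f g :: "real \<Rightarrow> 'a::real_normed_vector"
  shows "open U \<Longrightarrow> smooth_on f U \<Longrightarrow> smooth_on g U \<Longrightarrow> smooth_on (\<lambda>x. f x + g x) U"
  by (simp add: smooth_on_def C_diff_on_real_add)

lemma smooth_on_bounded_linear:
  "bounded_linear h \<Longrightarrow> open U \<Longrightarrow> smooth_on f U \<Longrightarrow> smooth_on (\<lambda>x. h (f x)) U"
  by (simp add: smooth_on_def C_diff_on_bounded_linear)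

lemma smooth_on_real_diff:
  fixes f g :: "real \<Rightarrow> 'a::real_normed_vector"
  assumes "open U" "smooth_on f U" "smooth_on g U"
  shows "smooth_on (\<lambda>x. f x - g x) U"
  using smooth_on_real_add[OF assms(1,2) smooth_on_bounded_linear[OF bounded_linear_minus[OF bounded_linear_ident] assms(1,3)]]
  by simp

lemma smooth_on_real_bilinear:
  fixes f :: "real \<Rightarrow> 'a::real_normed_vector" and g :: "real \<Rightarrow> 'b::real_normed_vector"
  shows "bounded_bilinear h \<Longrightarrow> open U \<Longrightarrow> smooth_on f U \<Longrightarrow> smooth_on g U \<Longrightarrow> smooth_on (\<lambda>x. h (f x) (g x)) U"
  by (simp add: smooth_on_def C_diff_on_real_bilinear)

lemmas smooth_on_real_mult = smooth_on_real_bilinear[OF bounded_bilinear_mult]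
lemmas smooth_on_real_scaleR = smooth_on_real_bilinear[OF bounded_bilinear_scaleR]
lemmas smooth_on_real_inner = smooth_on_real_bilinear[OF bounded_bilinear_inner]

lemma bounded_bilinear_cross3: "bounded_bilinear cross3"
  using bilinear_cross bilinear_conv_bounded_bilinear by blast

lemmas smooth_on_real_cross3 = smooth_on_real_bilinear[OF bounded_bilinear_cross3]

lemma smooth_on_real_inverse:
  fixes f :: "real \<Rightarrow> real"
  shows "open U \<Longrightarrow> (\<And>x. x \<in> U \<Longrightarrow> f x \<noteq> 0) \<Longrightarrow> smooth_on f U \<Longrightarrow> smooth_on (\<lambda>x. inverse (f x)) U"
  by (simp add: smooth_on_def C_diff_on_real_inverse)

lemma smooth_on_real_norm:
  fixes f :: "real \<Rightarrow> 'a::real_inner"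
  assumes "open U" "\<And>x. x \<in> U \<Longrightarrow> f x \<noteq> 0" "smooth_on f U"
  shows "smooth_on (\<lambda>x. norm (f x)) U"
proof -
  have "C_diff_on n (\<lambda>x. f x \<bullet> f x) U" for n
    using smooth_on_real_inner[OF assms(1,3,3)] by (simp add: smooth_on_def)
  then show ?thesis
    using C_diff_on_real_sqrt[OF assms(1), of "\<lambda>x. f x \<bullet> f x"] assms(2)
    by (simp add: smooth_on_def norm_eq_sqrt_inner)
qed

section \<open>Closed curves in a Lorentz space with null acceleration\<close>

lemma antiderivative_at:
  fixes f :: "real \<Rightarrow> 'a::banach"
  assumes "continuous_on {a..b} f"
  obtains g where "\<And>x. x \<in> {a<..<b} \<Longrightarrow> (g has_vector_derivative f x) (at x)" "g 0 = 0"
proof -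
  obtain g where g: "\<And>x. x \<in> {a..b} \<Longrightarrow> (g has_vector_derivative f x) (at x within {a..b})"
    using antiderivative_continuous[OF assms] by metis
  have "(g has_vector_derivative f x) (at x)" if "x \<in> {a<..<b}" for x
    using g[of x] that at_within_interior[of x "{a..b}"] by simp
  then have "((\<lambda>x. g x - g 0) has_vector_derivative f x) (at x)" if "x \<in> {a<..<b}" for x
    using that has_vector_derivative_diff[OF _ has_vector_derivative_const, of g "f x" "at x" "g 0"] by simp
  then show ?thesis using that[of "\<lambda>x. g x - g 0"] by simp
qed

lemma DERIV_nonpos_imp_le:
  fixes f :: "real \<Rightarrow> real"
  assumes "a \<le> b" "\<And>x. x \<in> {a..b} \<Longrightarrow> (f has_vector_derivative f' x) (at x)"
    "\<And>x. x \<in> {a..b} \<Longrightarrow> f' x \<le> 0"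
  shows "f b \<le> f a"
  by (rule DERIV_nonpos_imp_nonincreasing[OF assms(1)])
     (use assms(2,3) in \<open>auto simp: has_real_derivative_iff_has_vector_derivative\<close>)

text \<open>With \<open>\<theta>' = w\<close> and \<open>l\<close> the total angle, suppose \<open>l < 2 pi\<close> and let \<open>x r\<close> be \<open>\<theta> r - \<theta> u\<close> reduced modulo \<open>l\<close>
  to \<open>{- l/2..l/2}\<close>. Put \<open>B u = \<integral> w (cos x) \<sigma> dr\<close>. Since \<open>(x sin x)'' + x sin x = 2 cos x\<close>,
  integration by parts gives \<open>2 h (M u) (B u) = \<integral> (x sin x) h (M u) (M r) dr \<le> 0\<close>; and with the
  sine analogue \<open>E\<close> of \<open>B\<close>, the periodic function \<open>h \<epsilon> B - h \<sigma> E\<close> has the derivative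
  \<open>h M B - 2 w sin (l/2)\<close>, which is negative.\<close>

lemma closed_null_curve_length:
  fixes h :: "'a::euclidean_space \<Rightarrow> 'a \<Rightarrow> real" and \<sigma> \<epsilon> M :: "real \<Rightarrow> 'a" and w :: "real \<Rightarrow> real"
  assumes h: "bounded_bilinear h" and L: "L > 0"
    and w: "continuous_on UNIV w" "\<And>s. w s > 0"
    and \<sigma>: "\<And>s. (\<sigma> has_vector_derivative w s *\<^sub>R \<epsilon> s) (at s)"
    and \<epsilon>: "\<And>s. (\<epsilon> has_vector_derivative M s - w s *\<^sub>R \<sigma> s) (at s)"
    and per: "\<sigma> L = \<sigma> 0" "\<epsilon> L = \<epsilon> 0"
    and unit: "\<And>s. h (\<sigma> s) (\<sigma> s) = 1"
    and orth: "\<And>s. h (M s) (\<sigma> s) = 0"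
    and cone: "\<And>s r. h (M s) (M r) \<le> 0"
  shows "integral {0..L} w \<ge> 2 * pi"
proof (rule ccontr)
  assume less: "\<not> integral {0..L} w \<ge> 2 * pi"
  interpret h: bounded_bilinear h by (rule h)
  note bil = h.add_left h.add_right h.diff_left h.diff_right h.scaleR_left h.scaleR_right
    h.minus_left h.minus_right
  \<comment> \<open>The interval is padded so that 0 and L become interior points with two-sided
    derivatives; \<open>C\<close> and \<open>S\<close> get a smaller padding, on which \<theta> is
    already known to be continuous.\<close>
  obtain \<theta> where \<theta>': "\<And>s. s \<in> {-2<..<L+2} \<Longrightarrow> (\<theta> has_vector_derivative w s) (at s)" and \<theta>0: "\<theta> 0 = 0"
    by (rule antiderivative_at[OF continuous_on_subset[OF w(1) subset_UNIV, of "{-2..L+2}"]]) blast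
  have \<theta>: "(\<theta> has_vector_derivative w s) (at s)" if "s \<in> {0..L}" for s
    using \<theta>' that by simp
  define l where "l = \<theta> L"
  have "(w has_integral (\<theta> L - \<theta> 0)) {0..L}"
    by (rule fundamental_theorem_of_calculus) (use L \<theta> in \<open>auto intro: has_vector_derivative_at_within\<close>)
  then have l: "integral {0..L} w = l" by (simp add: l_def \<theta>0 integral_unique)
  have \<theta>_cont: "continuous_on {-1..L+1} \<theta>"
    by (rule continuous_at_imp_continuous_on, rule ballI, rule has_vector_derivative_continuous[OF \<theta>']) auto
  have \<theta>_DERIV: "(\<theta> has_real_derivative w s) (at s)" if "s \<in> {0..L}" for s
    using \<theta>[OF that] by (simp add: has_real_derivative_iff_has_vector_derivative)
  have mono: "\<theta> a \<le> \<theta> b" if "0 \<le> a" "a \<le> b" "b \<le> L" for a b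
  proof (rule DERIV_nonneg_imp_nondecreasing[OF that(2)])
    fix x assume "a \<le> x" "x \<le> b"
    then show "\<exists>y. (\<theta> has_real_derivative y) (at x) \<and> 0 \<le> y"
      using \<theta>_DERIV[of x] w(2)[of x] that by (intro exI[of _ "w x"]) auto
  qed
  have "\<theta> 0 < \<theta> L"
    by (rule DERIV_pos_imp_increasing[OF L]) (use \<theta>_DERIV w(2) in auto)
  then have l_bounds: "0 < l" "l < 2 * pi" using less l by (auto simp: \<theta>0 l_def)
  then have sin_pos: "sin (l/2) > 0" by (intro sin_gt_zero) auto
  have \<sigma>_cont: "continuous_on A \<sigma>" for A
    using \<sigma> by (auto intro!: continuous_at_imp_continuous_on has_vector_derivative_continuous)
  have w_cont: "continuous_on A w" for A
    by (rule continuous_on_subset[OF w(1)]) simp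
  have "continuous_on {-1..L+1} (\<lambda>s. (w s * cos (\<theta> s)) *\<^sub>R \<sigma> s)"
    by (intro continuous_intros w_cont \<theta>_cont \<sigma>_cont)
  then obtain C where C': "\<And>s. s \<in> {-1<..<L+1} \<Longrightarrow>
      (C has_vector_derivative (w s * cos (\<theta> s)) *\<^sub>R \<sigma> s) (at s)" and C0: "C 0 = 0"
    by (rule antiderivative_at) blast
  have "continuous_on {-1..L+1} (\<lambda>s. (w s * sin (\<theta> s)) *\<^sub>R \<sigma> s)"
    by (intro continuous_intros w_cont \<theta>_cont \<sigma>_cont)
  then obtain S where S': "\<And>s. s \<in> {-1<..<L+1} \<Longrightarrow>
      (S has_vector_derivative (w s * sin (\<theta> s)) *\<^sub>R \<sigma> s) (at s)" and S0: "S 0 = 0"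
    by (rule antiderivative_at) blast
  have C: "(C has_vector_derivative (w s * cos (\<theta> s)) *\<^sub>R \<sigma> s) (at s)"
    and S: "(S has_vector_derivative (w s * sin (\<theta> s)) *\<^sub>R \<sigma> s) (at s)" if "s \<in> {0..L}" for s
    using C' S' that by auto
  \<comment> \<open>By the addition formulas, \<open>B\<close> and \<open>E\<close> are the
    integrals over r of w cos x \<sigma> and w sin x \<sigma>, where x = \<theta> r - \<theta> s -
    l/2 for r > s and x = \<theta> r - \<theta> s + l/2 for r < s. The shift by l/2 places the jump
    of x, from l/2 to -l/2, at r = s.\<close>
  define B where "B s = cos (\<theta> s + l/2) *\<^sub>R (C L - C s) + sin (\<theta> s + l/2) *\<^sub>R (S L - S s)
    + cos (\<theta> s - l/2) *\<^sub>R C s + sin (\<theta> s - l/2) *\<^sub>R S s" for s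
  define E where "E s = cos (\<theta> s + l/2) *\<^sub>R (S L - S s) - sin (\<theta> s + l/2) *\<^sub>R (C L - C s)
    + cos (\<theta> s - l/2) *\<^sub>R S s - sin (\<theta> s - l/2) *\<^sub>R C s" for s
  \<comment> \<open>Effect of the jump of x: cos is even, so B' gets no term in \<sigma>; sin is odd
    and leaves 2 sin (l/2) \<sigma> in E'.\<close>
  have trig: "cos (\<theta> s) * cos (\<theta> s + l/2) + sin (\<theta> s) * sin (\<theta> s + l/2)
      = cos (\<theta> s) * cos (\<theta> s - l/2) + sin (\<theta> s) * sin (\<theta> s - l/2)"
    "sin (\<theta> s + l/2) * cos (\<theta> s) - cos (\<theta> s + l/2) * sin (\<theta> s) + cos (\<theta> s - l/2) * sin (\<theta> s)
      - sin (\<theta> s - l/2) * cos (\<theta> s) = 2 * sin (l/2)" for s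
  proof -
    show "cos (\<theta> s) * cos (\<theta> s + l/2) + sin (\<theta> s) * sin (\<theta> s + l/2)
      = cos (\<theta> s) * cos (\<theta> s - l/2) + sin (\<theta> s) * sin (\<theta> s - l/2)"
      using cos_diff[of "\<theta> s" "\<theta> s + l/2"] cos_diff[of "\<theta> s" "\<theta> s - l/2"] by simp
    show "sin (\<theta> s + l/2) * cos (\<theta> s) - cos (\<theta> s + l/2) * sin (\<theta> s) + cos (\<theta> s - l/2) * sin (\<theta> s)
      - sin (\<theta> s - l/2) * cos (\<theta> s) = 2 * sin (l/2)"
    proof -
      have "sin (l/2) = sin (\<theta> s + l/2) * cos (\<theta> s) - cos (\<theta> s + l/2) * sin (\<theta> s)"
        using sin_diff[of "\<theta> s + l/2" "\<theta> s"] by simp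
      moreover have "- sin (l/2) = sin (\<theta> s - l/2) * cos (\<theta> s) - cos (\<theta> s - l/2) * sin (\<theta> s)"
        using sin_diff[of "\<theta> s - l/2" "\<theta> s"] by simp
      ultimately show ?thesis by linarith
    qed
  qed
  have dB: "(B has_vector_derivative w s *\<^sub>R E s) (at s)" if "s \<in> {0..L}" for s
  proof -
    have "(B has_vector_derivative w s *\<^sub>R E s + (w s *
       (- (cos (\<theta> s) * cos (\<theta> s + l/2) + sin (\<theta> s) * sin (\<theta> s + l/2))
        + (cos (\<theta> s) * cos (\<theta> s - l/2) + sin (\<theta> s) * sin (\<theta> s - l/2)))) *\<^sub>R \<sigma> s) (at s)"
      unfolding B_def
      by (rule has_vector_derivative_eq_rhs)
         (use that in \<open>auto intro!: derivative_eq_intros \<theta>_DERIV C S simp: E_def algebra_simps\<close>)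
    then show ?thesis by (simp only: trig) simp
  qed
  have dE: "(E has_vector_derivative (2 * sin (l/2) * w s) *\<^sub>R \<sigma> s - w s *\<^sub>R B s) (at s)" if "s \<in> {0..L}" for s
  proof -
    have "(E has_vector_derivative (w s *
       (sin (\<theta> s + l/2) * cos (\<theta> s) - cos (\<theta> s + l/2) * sin (\<theta> s) + cos (\<theta> s - l/2) * sin (\<theta> s)
      - sin (\<theta> s - l/2) * cos (\<theta> s))) *\<^sub>R \<sigma> s - w s *\<^sub>R B s) (at s)"
      unfolding E_def
      by (rule has_vector_derivative_eq_rhs)
         (use that in \<open>auto intro!: derivative_eq_intros \<theta>_DERIV C S simp: B_def algebra_simps\<close>)
    then show ?thesis by (simp only: trig) (simp add: mult_ac)
  qed
  have MB: "h (M u) (B u) \<le> 0" if u: "u \<in> {0..L}" for u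
  proof -
    \<comment> \<open>Two integrations by parts against x sin x with x = \<theta> r - c; the terms
      in \<open>C\<close> and \<open>S\<close> supply 2 cos x \<sigma>, the defect of x sin x as a
      solution of f'' + f = 0. The two branches of x are c = \<theta> u + l/2 on {u..L} and c =
      \<theta> u - l/2 on {0..u}.\<close>
    define \<Phi> where "\<Phi> c r = h (M u) (((\<theta> r - c) * sin (\<theta> r - c)) *\<^sub>R \<epsilon> r
      - (sin (\<theta> r - c) + (\<theta> r - c) * cos (\<theta> r - c)) *\<^sub>R \<sigma> r
      + cos c *\<^sub>R (C r + C r) + sin c *\<^sub>R (S r + S r))" for c r
    have d\<Phi>: "(\<Phi> c has_vector_derivative (\<theta> r - c) * sin (\<theta> r - c) * h (M u) (M r)) (at r)"
      if r: "r \<in> {0..L}" for c r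
    proof -
      have "((\<lambda>r. ((\<theta> r - c) * sin (\<theta> r - c)) *\<^sub>R \<epsilon> r
      - (sin (\<theta> r - c) + (\<theta> r - c) * cos (\<theta> r - c)) *\<^sub>R \<sigma> r
      + cos c *\<^sub>R (C r + C r) + sin c *\<^sub>R (S r + S r)) has_vector_derivative
         ((\<theta> r - c) * sin (\<theta> r - c)) *\<^sub>R M r) (at r)"
        by (rule has_vector_derivative_eq_rhs)
           (use r in \<open>auto intro!: derivative_eq_intros \<theta>_DERIV C S \<epsilon> \<sigma> simp: cos_diff[of "\<theta> r" c] algebra_simps\<close>)
      from bounded_linear.has_vector_derivative[OF h.bounded_linear_right this, of "M u"]
      show ?thesis unfolding \<Phi>_def by (simp add: h.scaleR_right)
    qed
    have \<theta>_range: "0 \<le> \<theta> u" "\<theta> u \<le> l"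
      using mono[of 0 u] mono[of u L] u by (auto simp: \<theta>0 l_def)
    have x_sin_nonneg: "x * sin x \<ge> 0" if "\<bar>x\<bar> \<le> pi" for x :: real
      using sin_ge_zero[of x] sin_ge_zero[of "-x"] that
      by (cases "x \<ge> 0") (auto simp: mult_nonneg_nonneg mult_nonpos_nonpos)
    have "\<Phi> (\<theta> u + l/2) L \<le> \<Phi> (\<theta> u + l/2) u"
    proof (rule DERIV_nonpos_imp_le[OF _ d\<Phi>])
      fix r assume r: "r \<in> {u..L}"
      then have "\<theta> u \<le> \<theta> r" "\<theta> r \<le> l" using mono[of u r] mono[of r L] u by (auto simp: l_def)
      then have "\<bar>\<theta> r - (\<theta> u + l/2)\<bar> \<le> pi" using l_bounds \<theta>_range by auto
      then show "(\<theta> r - (\<theta> u + l/2)) * sin (\<theta> r - (\<theta> u + l/2)) * h (M u) (M r) \<le> 0"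
        using x_sin_nonneg cone by (simp add: mult_nonneg_nonpos)
    qed (use u in auto)
    moreover have "\<Phi> (\<theta> u - l/2) u \<le> \<Phi> (\<theta> u - l/2) 0"
    proof (rule DERIV_nonpos_imp_le[OF _ d\<Phi>])
      fix r assume r: "r \<in> {0..u}"
      then have "0 \<le> \<theta> r" "\<theta> r \<le> \<theta> u" using mono[of 0 r] mono[of r u] u by (auto simp: \<theta>0)
      then have "\<bar>\<theta> r - (\<theta> u - l/2)\<bar> \<le> pi" using l_bounds \<theta>_range by auto
      then show "(\<theta> r - (\<theta> u - l/2)) * sin (\<theta> r - (\<theta> u - l/2)) * h (M u) (M r) \<le> 0"
        using x_sin_nonneg cone by (simp add: mult_nonneg_nonpos)
    qed (use u in auto)
    \<comment> \<open>At L and 0 the values of x agree, so periodicity cancels the terms in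
      \<epsilon> and \<sigma>. At u the coefficient of \<epsilon> is even in x and cancels, while
      the odd coefficient of \<sigma> is removed by \<open>orth\<close>. Only the terms in
      \<open>C\<close> and \<open>S\<close> survive.\<close>
    moreover have "\<Phi> (\<theta> u + l/2) L - \<Phi> (\<theta> u + l/2) u + \<Phi> (\<theta> u - l/2) u - \<Phi> (\<theta> u - l/2) 0
      = 2 * h (M u) (B u)"
    proof -
      have x: "\<theta> L - (\<theta> u + l/2) = \<theta> 0 - (\<theta> u - l/2)" "\<theta> u - (\<theta> u + l/2) = - (l/2)"
        "\<theta> u - (\<theta> u - l/2) = l/2"
        by (auto simp: \<theta>0 l_def)
      show ?thesis
        unfolding \<Phi>_def B_def x per C0 S0
        by (simp add: bil orth algebra_simps h.zero_right)
    qed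
    ultimately show ?thesis by simp
  qed
  \<comment> \<open>This is the boundary term of Green's identity for f'' + f applied to
    \<open>B\<close> and \<sigma>.\<close>
  define \<Psi> where "\<Psi> s = h (\<epsilon> s) (B s) - h (\<sigma> s) (E s)" for s
  have d\<Psi>: "(\<Psi> has_vector_derivative h (M s) (B s) - 2 * sin (l/2) * w s) (at s)" if "s \<in> {0..L}" for s
    unfolding \<Psi>_def
    by (rule has_vector_derivative_eq_rhs[OF has_vector_derivative_diff[OF
          h.has_vector_derivative[OF \<epsilon> dB[OF that]] h.has_vector_derivative[OF \<sigma> dE[OF that]]]])
       (simp add: bil unit algebra_simps)
  have "\<Psi> L < \<Psi> 0"
  proof (rule DERIV_neg_imp_decreasing[OF L])
    fix x assume "0 \<le> x" "x \<le> L"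
    then show "\<exists>y. (\<Psi> has_real_derivative y) (at x) \<and> y < 0"
      using d\<Psi>[of x] MB[of x] mult_pos_pos[OF sin_pos w(2)[of x]]
      by (intro exI[of _ "h (M x) (B x) - 2 * sin (l/2) * w x"])
         (auto simp: has_real_derivative_iff_has_vector_derivative)
  qed
  moreover have "B L = B 0" "E L = E 0"
    by (auto simp: B_def E_def C0 S0 \<theta>0 l_def[symmetric])
  ultimately show False by (simp add: \<Psi>_def per)
qed

section \<open>Arc-length calculus and order of contact\<close>

definition vanishes_to_order :: "nat \<Rightarrow> (real \<Rightarrow> real) \<Rightarrow> real \<Rightarrow> bool" where
  "vanishes_to_order n f s \<longleftrightarrow> (\<forall>j\<le>n. (deriv ^^ j) f s = 0)"

lemma vanishes_to_order_0: "vanishes_to_order 0 f s \<longleftrightarrow> f s = 0"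
  by (simp add: vanishes_to_order_def)

lemma vanishes_to_order_Suc:
  "vanishes_to_order (Suc n) f s \<longleftrightarrow> f s = 0 \<and> vanishes_to_order n (deriv f) s"
proof -
  have "(\<forall>j\<le>Suc n. P j) \<longleftrightarrow> P 0 \<and> (\<forall>j\<le>n. P (Suc j))" for P
    by (metis Suc_le_mono le0 not0_implies_Suc)
  then show ?thesis by (simp add: vanishes_to_order_def funpow_Suc_right del: funpow.simps(2))
qed

lemma vanishes_to_order_lower: "vanishes_to_order (Suc n) f s \<Longrightarrow> vanishes_to_order n f s"
  by (simp add: vanishes_to_order_def)

lemma vanishes_to_order_cong:
  assumes "open I" "s \<in> I" "\<And>x. x \<in> I \<Longrightarrow> f x = g x"
  shows "vanishes_to_order n f s \<longleftrightarrow> vanishes_to_order n g s"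
proof -
  have "(deriv ^^ j) f x = (deriv ^^ j) g x" if "x \<in> I" for j x
    using that
  proof (induction j arbitrary: x)
    case (Suc j)
    have "\<forall>\<^sub>F y in nhds x. (deriv ^^ j) f y = (deriv ^^ j) g y"
      using Suc assms(1) by (auto simp: eventually_nhds)
    then show ?case by (simp add: deriv_cong_ev)
  qed (simp add: assms(3))
  then show ?thesis using assms(2) by (simp add: vanishes_to_order_def)
qed

lemma smooth_on_deriv:
  fixes f :: "real \<Rightarrow> real"
  assumes "open I" "smooth_on f I"
  shows "smooth_on (deriv f) I" "x \<in> I \<Longrightarrow> (f has_real_derivative deriv f x) (at x)"
  using smooth_on_vector_derivative[OF assms] smooth_on_has_vector_derivative[OF assms]
  by (simp_all add: field_derivative_eq_vector_derivative[abs_def] has_real_derivative_iff_has_vector_derivative)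

lemma vanishes_to_order_add:
  assumes "open I" "s \<in> I" "smooth_on f I" "smooth_on g I"
    "vanishes_to_order n f s" "vanishes_to_order n g s"
  shows "vanishes_to_order n (\<lambda>x. f x + g x) s"
  using assms(3-)
proof (induction n arbitrary: f g)
  case (Suc n)
  have "deriv (\<lambda>x. f x + g x) x = deriv f x + deriv g x" if "x \<in> I" for x
    using smooth_on_deriv(2)[OF assms(1)] Suc.prems that by (intro DERIV_imp_deriv derivative_intros)
  then show ?case
    using Suc smooth_on_deriv(1)[OF assms(1)]
    by (subst vanishes_to_order_Suc, subst vanishes_to_order_cong[OF assms(1,2)])
       (auto simp: vanishes_to_order_Suc)
qed (simp add: vanishes_to_order_0)

text \<open>By the Leibniz rule, smooth functions vanishing to a given order are closed under smooth
  multiples. This makes contact insensitive to reparametrization and to conformal factors.\<close>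

lemma vanishes_to_order_mult:
  assumes "open I" "s \<in> I" "smooth_on h I" "smooth_on f I" "vanishes_to_order n f s"
  shows "vanishes_to_order n (\<lambda>x. h x * f x) s"
  using assms(3-)
proof (induction n arbitrary: h f)
  case (Suc n)
  note d = smooth_on_deriv[OF assms(1)]
  have "deriv (\<lambda>x. h x * f x) x = deriv h x * f x + h x * deriv f x" if "x \<in> I" for x
    using d(2)[OF Suc.prems(1) that] d(2)[OF Suc.prems(2) that]
    by (intro DERIV_imp_deriv) (auto intro!: derivative_eq_intros)
  moreover have "vanishes_to_order n (\<lambda>x. deriv h x * f x + h x * deriv f x) s"
    using Suc.prems d(1) vanishes_to_order_lower[OF Suc.prems(3)]
    by (intro vanishes_to_order_add[OF assms(1,2)] Suc.IH smooth_on_real_mult[OF assms(1)])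
       (auto simp: vanishes_to_order_Suc)
  ultimately show ?case
    using Suc.prems(3) by (subst vanishes_to_order_Suc, subst vanishes_to_order_cong[OF assms(1,2)])
       (auto simp: vanishes_to_order_Suc)
qed (simp add: vanishes_to_order_0)

section \<open>Differentiation with respect to arc-length\<close>

text \<open>The relation multiplies by the speed instead of dividing by it, so the sum and product
  rules hold without regularity, which enters only in the comparison with \<open>arc_deriv\<close>
  and in uniqueness.\<close>

definition has_arc_deriv ::
    "(real \<Rightarrow> real^3) \<Rightarrow> (real \<Rightarrow> 'b::real_normed_vector) \<Rightarrow> 'b \<Rightarrow> real \<Rightarrow> bool" where
  "has_arc_deriv g f f' s \<longleftrightarrow>
     (f has_vector_derivative norm (vector_derivative g (at s)) *\<^sub>R f') (at s)"

lemma has_arc_deriv_const: "has_arc_deriv g (\<lambda>x. c) 0 s"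
  by (simp add: has_arc_deriv_def)

lemma has_arc_deriv_add:
  "has_arc_deriv g f f' s \<Longrightarrow> has_arc_deriv g h h' s \<Longrightarrow> has_arc_deriv g (\<lambda>x. f x + h x) (f' + h') s"
  unfolding has_arc_deriv_def scaleR_add_right by (rule has_vector_derivative_add)

lemma has_arc_deriv_diff:
  "has_arc_deriv g f f' s \<Longrightarrow> has_arc_deriv g h h' s \<Longrightarrow> has_arc_deriv g (\<lambda>x. f x - h x) (f' - h') s"
  unfolding has_arc_deriv_def scaleR_diff_right by (rule has_vector_derivative_diff)

lemma has_arc_deriv_bilinear:
  assumes "bounded_bilinear b" "has_arc_deriv g f f' s" "has_arc_deriv g h h' s"
  shows "has_arc_deriv g (\<lambda>x. b (f x) (h x)) (b f' (h s) + b (f s) h') s"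
proof -
  interpret bounded_bilinear b by fact
  show ?thesis
    using has_vector_derivative[OF assms(2,3)[unfolded has_arc_deriv_def]]
    by (simp add: has_arc_deriv_def scaleR_left scaleR_right scaleR_add_right add.commute)
qed

lemmas has_arc_deriv_mult = has_arc_deriv_bilinear[OF bounded_bilinear_mult]
lemmas has_arc_deriv_scaleR = has_arc_deriv_bilinear[OF bounded_bilinear_scaleR]
lemmas has_arc_deriv_inner = has_arc_deriv_bilinear[OF bounded_bilinear_inner]
lemmas has_arc_deriv_cross3 = has_arc_deriv_bilinear[OF bounded_bilinear_cross3]

lemmas has_arc_deriv_intros = has_arc_deriv_const has_arc_deriv_add has_arc_deriv_diff
  has_arc_deriv_mult has_arc_deriv_scaleR has_arc_deriv_inner has_arc_deriv_cross3

section \<open>Tangent, curvature vector and drift of a regular curve\<close>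

definition curvature_vector :: "(real \<Rightarrow> real^3) \<Rightarrow> real \<Rightarrow> real^3" where
  "curvature_vector g = arc_deriv g (unit_tangent g)"

text \<open>Differentiating \<open>K \<bullet> t = 0\<close> shows that the added term cancels the tangential part of the first one.\<close>

definition curvature_drift :: "(real \<Rightarrow> real^3) \<Rightarrow> real \<Rightarrow> real^3" where
  "curvature_drift g s = arc_deriv g (curvature_vector g) s
     + (curvature_vector g s \<bullet> curvature_vector g s) *\<^sub>R unit_tangent g s"

definition drift_det :: "(real \<Rightarrow> real^3) \<Rightarrow> real \<Rightarrow> real" where
  "drift_det g s =
     cross3 (unit_tangent g s) (curvature_drift g s) \<bullet> arc_deriv g (curvature_drift g) s"

lemma orthonormal_expansion:
  fixes t n x :: "real^3"
  assumes "t \<bullet> t = 1" "n \<bullet> n = 1" "t \<bullet> n = 0"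
  shows "x = (x \<bullet> t) *\<^sub>R t + (x \<bullet> n) *\<^sub>R n + (x \<bullet> cross3 t n) *\<^sub>R cross3 t n"
proof -
  define b z where "b = cross3 t n" and
    "z = x - ((x \<bullet> t) *\<^sub>R t + (x \<bullet> n) *\<^sub>R n + (x \<bullet> b) *\<^sub>R b)"
  have b: "b \<bullet> b = 1" "b \<bullet> t = 0" "b \<bullet> n = 0" "t \<bullet> b = 0" "n \<bullet> b = 0"
    using assms by (simp_all add: b_def dot_cross dot_cross_self inner_commute)
  have z: "z \<bullet> t = 0" "z \<bullet> n = 0" "z \<bullet> b = 0"
    using assms b by (simp_all add: z_def inner_simps inner_commute)
  \<comment> \<open>The triple product identity makes \<open>z\<close> parallel to \<open>b\<close>,
    to which it is also orthogonal.\<close>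
  have "cross3 z b = (z \<bullet> n) *\<^sub>R t - (z \<bullet> t) *\<^sub>R n"
    unfolding b_def by (simp add: vec_eq_iff forall_3 cross3_simps)
  then have "cross3 z b = 0" using z by simp
  then have "z = 0 \<or> b = 0" using z(3) norm_and_cross_eq_0 by blast
  then have "z = 0" using b(1) by auto
  then show ?thesis by (simp add: z_def b_def)
qed

lemma cross3_cross3_self: "cross3 t (cross3 t n) = (t \<bullet> n) *\<^sub>R t - (t \<bullet> t) *\<^sub>R n"
  by (simp add: vec_eq_iff forall_3 cross3_simps)

text \<open>An open parameter set is needed because the Moebius image of a curve is smooth only away
  from the pole, and because the Frenet frame exists only where the curvature is nonzero.\<close>

locale regular_curve =
  fixes g :: "real \<Rightarrow> real^3" and I :: "real set"
  assumes open_I: "open I" and smooth: "smooth_on g I"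
    and regular: "\<And>s. s \<in> I \<Longrightarrow> vector_derivative g (at s) \<noteq> 0"
begin

abbreviation (input) "t \<equiv> unit_tangent g"
abbreviation (input) "K \<equiv> curvature_vector g"
abbreviation (input) "W \<equiv> curvature_drift g"
abbreviation (input) "D f \<equiv> arc_deriv g f"

lemmas smooth_intros = smooth_on_real_const[OF open_I] smooth_on_real_add[OF open_I]
  smooth_on_real_diff[OF open_I] smooth_on_real_mult[OF open_I] smooth_on_real_scaleR[OF open_I]
  smooth_on_real_inner[OF open_I] smooth_on_real_cross3[OF open_I]

lemma smooth_speed: "smooth_on (\<lambda>s. norm (vector_derivative g (at s))) I"
  by (intro smooth_on_real_norm open_I regular smooth_on_vector_derivative smooth)

lemma smooth_arc_deriv: "smooth_on f I \<Longrightarrow> smooth_on (D f) I"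
  unfolding arc_deriv_def[abs_def]
  by (intro smooth_on_real_scaleR smooth_on_real_inverse open_I smooth_speed smooth_on_vector_derivative)
     (simp_all add: regular)

lemma smooth_t: "smooth_on t I"
  unfolding unit_tangent_def by (intro smooth_arc_deriv smooth)

lemma smooth_K: "smooth_on K I"
  unfolding curvature_vector_def by (intro smooth_arc_deriv smooth_t)

lemma smooth_W: "smooth_on W I"
  unfolding curvature_drift_def[abs_def] by (intro smooth_intros smooth_arc_deriv smooth_t smooth_K)

lemma has_arc_derivI: "smooth_on f I \<Longrightarrow> s \<in> I \<Longrightarrow> has_arc_deriv g f (D f s) s"
  using smooth_on_has_vector_derivative[OF open_I] regular by (simp add: has_arc_deriv_def arc_deriv_def)

lemma has_arc_deriv_unique:
  assumes "has_arc_deriv g f a s" "has_arc_deriv g f b s" "s \<in> I"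
  shows "a = b"
  using vector_derivative_unique_at[OF assms(1,2)[unfolded has_arc_deriv_def]] regular[OF assms(3)] by simp

lemma has_arc_deriv_cong:
  assumes "\<And>x. x \<in> I \<Longrightarrow> f x = h x" "has_arc_deriv g f a s" "s \<in> I"
  shows "has_arc_deriv g h a s"
  using has_vector_derivative_transform_within_open[OF assms(2)[unfolded has_arc_deriv_def] open_I assms(3,1)]
  by (simp add: has_arc_deriv_def)

lemma arc_deriv_eq: "has_arc_deriv g f a s \<Longrightarrow> s \<in> I \<Longrightarrow> D f s = a"
  using vector_derivative_at[of f _ s] regular unfolding has_arc_deriv_def arc_deriv_def by fastforce

lemma has_arc_deriv_constant:
  assumes "\<And>x. x \<in> I \<Longrightarrow> f x = c" "has_arc_deriv g f a s" "s \<in> I"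
  shows "a = 0"
  using has_arc_deriv_unique[OF has_arc_deriv_cong[OF assms] has_arc_deriv_const assms(3)] .

lemma D_g: "s \<in> I \<Longrightarrow> has_arc_deriv g g (t s) s"
  unfolding unit_tangent_def by (rule has_arc_derivI[OF smooth])

lemma D_t: "s \<in> I \<Longrightarrow> has_arc_deriv g t (K s) s"
  unfolding curvature_vector_def by (rule has_arc_derivI[OF smooth_t])

lemma D_K: "s \<in> I \<Longrightarrow> has_arc_deriv g K (W s - (K s \<bullet> K s) *\<^sub>R t s) s"
  using has_arc_derivI[OF smooth_K] by (simp add: curvature_drift_def)

lemma D_W: "s \<in> I \<Longrightarrow> has_arc_deriv g W (D W s) s"
  by (rule has_arc_derivI[OF smooth_W])

lemma inner_t_t: "s \<in> I \<Longrightarrow> t s \<bullet> t s = 1"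
  using regular by (simp add: unit_tangent_def arc_deriv_def dot_square_norm power2_eq_square)

lemma inner_t_K: "s \<in> I \<Longrightarrow> t s \<bullet> K s = 0"
  using has_arc_deriv_constant[OF inner_t_t has_arc_deriv_inner[OF D_t D_t]] by (simp add: inner_commute)

lemma inner_t_W: "s \<in> I \<Longrightarrow> t s \<bullet> W s = 0"
  using has_arc_deriv_constant[OF inner_t_K has_arc_deriv_inner[OF D_t D_K]] inner_t_t
  by (simp add: inner_commute inner_simps)

text \<open>The parameter derivative is the arc-length derivative times a smooth speed, so orders of
  vanishing may be counted with arc-length derivatives.\<close>

lemma vanishes_to_order_arc:
  assumes "\<And>x. x \<in> I \<Longrightarrow> has_arc_deriv g f (f1 x) x" "smooth_on f1 I" "s \<in> I" "f s = 0"
    "vanishes_to_order n f1 s"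
  shows "vanishes_to_order (Suc n) f s"
proof -
  have "deriv f x = norm (vector_derivative g (at x)) * f1 x" if "x \<in> I" for x
    using assms(1)[OF that]
    by (simp add: has_arc_deriv_def DERIV_imp_deriv has_real_derivative_iff_has_vector_derivative)
  then have "vanishes_to_order n (deriv f) s \<longleftrightarrow>
      vanishes_to_order n (\<lambda>x. norm (vector_derivative g (at x)) * f1 x) s"
    by (rule vanishes_to_order_cong[OF open_I assms(3)])
  with vanishes_to_order_mult[OF open_I assms(3) smooth_speed assms(2,5)]
  have "vanishes_to_order n (deriv f) s" by simp
  then show ?thesis by (simp add: vanishes_to_order_Suc assms(4))
qed

text \<open>The sphere tangent to the curve at \<open>s\<close> with normal \<open>\<nu>\<close> and containing the osculating circle:
  its third and fourth order contact conditions are \<open>\<nu> \<bullet> W = 0\<close> and \<open>\<nu> \<bullet> D W = 0\<close>.\<close>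

lemma order_four_contact:
  assumes s: "s \<in> I" and \<nu>: "\<nu> \<bullet> t s = 0" "\<nu> \<bullet> W s = 0" "\<nu> \<bullet> D W s = 0"
  shows "vanishes_to_order 4
    (\<lambda>x. \<nu> \<bullet> (g x - g s) - (\<nu> \<bullet> K s / 2) * ((g x - g s) \<bullet> (g x - g s))) s"
proof -
  \<comment> \<open>With this value the second arc-length derivative, which is \<nu> \<bullet> K - c
    at \<open>s\<close>, vanishes there.\<close>
  define c where "c = \<nu> \<bullet> K s"
  have y: "has_arc_deriv g (\<lambda>x. g x - g s) (t x) x" if "x \<in> I" for x
    using has_arc_deriv_diff[OF D_g[OF that] has_arc_deriv_const] by simp
  have sm: "smooth_on (\<lambda>x. g x - g s) I" by (intro smooth_intros smooth)
  note smi = smooth_intros smooth smooth_t smooth_K smooth_W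
  have d1: "has_arc_deriv g (\<lambda>x. \<nu> \<bullet> (g x - g s) - (c/2) * ((g x - g s) \<bullet> (g x - g s)))
      (\<nu> \<bullet> t x - c * ((g x - g s) \<bullet> t x)) x" if "x \<in> I" for x
    using has_arc_deriv_diff[OF has_arc_deriv_inner[OF has_arc_deriv_const[of _ \<nu>] y]
      has_arc_deriv_mult[OF has_arc_deriv_const[of _ "c/2"] has_arc_deriv_inner[OF y y]]] that
    by (simp add: inner_commute)
  have d2: "has_arc_deriv g (\<lambda>x. \<nu> \<bullet> t x - c * ((g x - g s) \<bullet> t x))
      (\<nu> \<bullet> K x - c * (1 + (g x - g s) \<bullet> K x)) x" if "x \<in> I" for x
    using has_arc_deriv_diff[OF has_arc_deriv_inner[OF has_arc_deriv_const[of _ \<nu>] D_t]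
      has_arc_deriv_mult[OF has_arc_deriv_const[of _ c] has_arc_deriv_inner[OF y D_t]]] that
    by (simp add: inner_t_t)
  have d3: "has_arc_deriv g (\<lambda>x. \<nu> \<bullet> K x - c * (1 + (g x - g s) \<bullet> K x))
      (\<nu> \<bullet> (W x - (K x \<bullet> K x) *\<^sub>R t x) - c * ((g x - g s) \<bullet> (W x - (K x \<bullet> K x) *\<^sub>R t x))) x" if "x \<in> I" for x
    using has_arc_deriv_diff[OF has_arc_deriv_inner[OF has_arc_deriv_const[of _ \<nu>] D_K]
      has_arc_deriv_mult[OF has_arc_deriv_const[of _ c] has_arc_deriv_add[OF has_arc_deriv_const[of _ 1] has_arc_deriv_inner[OF y D_K]]]] that
    by (simp add: inner_t_K)
  define U where "U x = W x - (K x \<bullet> K x) *\<^sub>R t x" for x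
  have smU: "smooth_on U I" unfolding U_def[abs_def] by (intro smi)
  have dU: "has_arc_deriv g U (D W x - ((2 * (K x \<bullet> U x)) *\<^sub>R t x + (K x \<bullet> K x) *\<^sub>R K x)) x" if "x \<in> I" for x
    using has_arc_deriv_diff[OF D_W has_arc_deriv_scaleR[OF has_arc_deriv_inner[OF D_K D_K] D_t]] that
    unfolding U_def[abs_def] by (simp add: inner_commute algebra_simps)
  have d4: "has_arc_deriv g (\<lambda>x. \<nu> \<bullet> U x - c * ((g x - g s) \<bullet> U x))
      (\<nu> \<bullet> D U x - c * (t x \<bullet> U x + (g x - g s) \<bullet> D U x)) x" if "x \<in> I" for x
    using has_arc_deriv_diff[OF has_arc_deriv_inner[OF has_arc_deriv_const[of _ \<nu>] has_arc_derivI[OF smU]]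
      has_arc_deriv_mult[OF has_arc_deriv_const[of _ c] has_arc_deriv_inner[OF y has_arc_derivI[OF smU]]]] that
    by simp
  \<comment> \<open>\<open>U\<close> is the derivative of \<open>K\<close>. At \<open>s\<close> the
    term \<nu> \<bullet> D U contributes - c |K|^2, and t \<bullet> U = - |K|^2, so the two
    contributions cancel.\<close>
  have "vanishes_to_order 0 (\<lambda>x. \<nu> \<bullet> D U x - c * (t x \<bullet> U x + (g x - g s) \<bullet> D U x)) s"
    using s \<nu> arc_deriv_eq[OF dU[OF s] s] inner_t_t[OF s] inner_t_W[OF s]
    by (simp add: vanishes_to_order_0 inner_simps U_def c_def)
  then have "vanishes_to_order (Suc 0) (\<lambda>x. \<nu> \<bullet> U x - c * ((g x - g s) \<bullet> U x)) s"
    by (rule vanishes_to_order_arc[OF d4 _ s, rotated -1])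
       (use \<nu> in \<open>auto intro!: smi smU smooth_arc_deriv simp: U_def inner_simps\<close>)
  then have "vanishes_to_order (Suc (Suc 0)) (\<lambda>x. \<nu> \<bullet> K x - c * (1 + (g x - g s) \<bullet> K x)) s"
    unfolding U_def by (rule vanishes_to_order_arc[OF d3 _ s, rotated -1])
       (auto intro!: smi simp: c_def)
  then have "vanishes_to_order (Suc (Suc (Suc 0))) (\<lambda>x. \<nu> \<bullet> t x - c * ((g x - g s) \<bullet> t x)) s"
    by (rule vanishes_to_order_arc[OF d2 _ s, rotated -1]) (use \<nu> in \<open>auto intro!: smi\<close>)
  then have "vanishes_to_order (Suc (Suc (Suc (Suc 0))))
      (\<lambda>x. \<nu> \<bullet> (g x - g s) - (c/2) * ((g x - g s) \<bullet> (g x - g s))) s"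
    by (rule vanishes_to_order_arc[OF d1 _ s, rotated -1]) (auto intro!: smi)
  then show ?thesis by (simp add: c_def numeral_eq_Suc)
qed

end

section \<open>Comparison with the Euclidean formulas\<close>

context regular_curve
begin

text \<open>The Frenet equations give W = k' N + k \<tau> B. Its squared length is the expression
  under the fourth root, and expanding det (t, W, D W) in the frame gives the numerator of the
  torsion.\<close>

lemma euclidean_conformal_formulas:
  assumes s: "s \<in> I" and K: "\<And>x. x \<in> I \<Longrightarrow> K x \<noteq> 0"
  shows "euclidean_conformal_torsion g s = drift_det g s / (W s \<bullet> W s) powr (5/4)"
    and "euclidean_conformal_speed g s = root 4 (W s \<bullet> W s) * norm (vector_derivative g (at s))"
proof -
  define k N B \<tau> where "k = curvature g" and "N = principal_normal g" and "B = binormal g"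
    and "\<tau> = torsion g"
  have k: "k x = norm (K x)" for x
    by (simp add: k_def curvature_def curvature_vector_def)
  have N: "N x = inverse (k x) *\<^sub>R K x" for x
    by (simp add: N_def k_def principal_normal_def curvature_vector_def)
  have B: "B x = cross3 (t x) (N x)" for x
    by (simp add: B_def N_def binormal_def)
  have \<tau>: "\<tau> x = - (D B x \<bullet> N x)" for x
    by (simp add: \<tau>_def B_def N_def torsion_def)
  have k_pos: "k x > 0" if "x \<in> I" for x using K[OF that] by (simp add: k)
  have KN: "K x = k x *\<^sub>R N x" if "x \<in> I" for x using k_pos[OF that] by (simp add: N)
  have smooth_k: "smooth_on k I"
    unfolding k[abs_def] by (intro smooth_on_real_norm open_I K smooth_K)
  have smooth_N: "smooth_on N I"
    unfolding N[abs_def] using k_pos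
    by (intro smooth_on_real_scaleR smooth_on_real_inverse open_I smooth_K smooth_k) force
  have smooth_B: "smooth_on B I"
    unfolding B[abs_def] by (intro smooth_intros smooth_t smooth_N)
  have smooth_\<tau>: "smooth_on \<tau> I"
    using smooth_on_real_diff[OF open_I smooth_on_real_const[OF open_I, of 0]
        smooth_on_real_inner[OF open_I smooth_arc_deriv[OF smooth_B] smooth_N]]
    by (simp add: \<tau>[abs_def])
  have NN: "N x \<bullet> N x = 1" if "x \<in> I" for x
    using k_pos[OF that] by (simp add: N k dot_square_norm power2_eq_square)
  have tN: "t x \<bullet> N x = 0" if "x \<in> I" for x using inner_t_K[OF that] by (simp add: N)
  have BB: "B x \<bullet> B x = 1" if "x \<in> I" for x
    unfolding B dot_cross inner_commute[of "N x" "t x"]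
    by (simp add: that inner_t_t NN tN)
  have tB: "t x \<bullet> B x = 0" "N x \<bullet> B x = 0" for x
    by (simp_all add: B dot_cross_self)
  have DB: "has_arc_deriv g B (D B x) x" if "x \<in> I" for x
    by (rule has_arc_derivI[OF smooth_B that])
  have DN: "has_arc_deriv g N (- k x *\<^sub>R t x + \<tau> x *\<^sub>R B x) x" if x: "x \<in> I" for x
  proof -
    note D = has_arc_derivI[OF smooth_N x]
    have "D N x \<bullet> N x = 0"
      using has_arc_deriv_constant[OF NN has_arc_deriv_inner[OF D D] x] by (simp add: inner_commute)
    moreover have "D N x \<bullet> t x = - k x"
      using has_arc_deriv_constant[OF tN has_arc_deriv_inner[OF D_t[OF x] D] x] KN[OF x] NN[OF x]
      by (simp add: inner_commute)
    moreover have "D N x \<bullet> B x = \<tau> x"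
      using has_arc_deriv_constant[OF tB(2) has_arc_deriv_inner[OF D DB[OF x]] x]
      by (simp add: inner_commute \<tau>)
    ultimately show ?thesis
      using D orthonormal_expansion[OF inner_t_t[OF x] NN[OF x] tN[OF x], of "D N x"] B[of x] by simp
  qed
  have cross_tB: "cross3 (t x) (B x) = - N x" if "x \<in> I" for x
    using that by (simp add: B cross3_cross3_self tN inner_t_t)
  have DB': "has_arc_deriv g B (- \<tau> x *\<^sub>R N x) x" if x: "x \<in> I" for x
    using has_arc_deriv_cross3[OF D_t[OF x] DN[OF x]]
    by (simp add: B[symmetric] KN[OF x] cross_mult_left cross_mult_right Cross3.right_diff_distrib
        cross_tB[OF x])
  note Dk = has_arc_derivI[OF smooth_k] and D\<tau> = has_arc_derivI[OF smooth_\<tau>]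
    and Dk' = has_arc_derivI[OF smooth_arc_deriv[OF smooth_k]]
  have W: "W x = D k x *\<^sub>R N x + (k x * \<tau> x) *\<^sub>R B x" if x: "x \<in> I" for x
  proof -
    have "has_arc_deriv g K (k x *\<^sub>R (- k x *\<^sub>R t x + \<tau> x *\<^sub>R B x) + D k x *\<^sub>R N x) x"
      using has_arc_deriv_cong[OF KN[symmetric] has_arc_deriv_scaleR[OF Dk[OF x] DN[OF x]] x]
      by (simp add: add.commute)
    then have "W x - (K x \<bullet> K x) *\<^sub>R t x = k x *\<^sub>R (- k x *\<^sub>R t x + \<tau> x *\<^sub>R B x) + D k x *\<^sub>R N x"
      by (rule has_arc_deriv_unique[OF D_K[OF x] _ x])
    then show ?thesis
      by (simp add: KN[OF x] NN[OF x] algebra_simps)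
  qed
  define DW where "DW x = D (D k) x *\<^sub>R N x + D k x *\<^sub>R (- k x *\<^sub>R t x + \<tau> x *\<^sub>R B x)
      + (D k x * \<tau> x + k x * D \<tau> x) *\<^sub>R B x + (k x * \<tau> x) *\<^sub>R (- \<tau> x *\<^sub>R N x)" for x
  have "has_arc_deriv g W (DW x) x" if x: "x \<in> I" for x
    using has_arc_deriv_cong[OF W[symmetric] has_arc_deriv_add[OF has_arc_deriv_scaleR[OF Dk'[OF x] DN[OF x]]
      has_arc_deriv_scaleR[OF has_arc_deriv_mult[OF Dk[OF x] D\<tau>[OF x]] DB'[OF x]]] x]
    by (simp add: DW_def algebra_simps)
  then have DW: "D W s = DW s" using s by (intro arc_deriv_eq)
  have tW: "cross3 (t s) (W s) = D k s *\<^sub>R B s - (k s * \<tau> s) *\<^sub>R N s"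
    by (simp add: W[OF s] cross_add_right cross_mult_right cross_tB[OF s] B[symmetric])
  have dots: "N s \<bullet> N s = 1" "B s \<bullet> B s = 1" "N s \<bullet> B s = 0" "B s \<bullet> N s = 0" "N s \<bullet> t s = 0" "B s \<bullet> t s = 0"
    using s tN[OF s] tB[of s] by (simp_all add: NN BB inner_commute)
  have WW: "W s \<bullet> W s = (D k s)\<^sup>2 + (k s)\<^sup>2 * (\<tau> s)\<^sup>2"
    by (simp add: W[OF s] inner_simps dots) (simp add: power2_eq_square)
  have det: "drift_det g s = 2 * (D k s)\<^sup>2 * \<tau> s + (k s)\<^sup>2 * \<tau> s ^ 3 + k s * D k s * D \<tau> s - k s * D (D k) s * \<tau> s"
    unfolding drift_det_def tW DW DW_def
    by (simp add: inner_simps dots) (simp add: power2_eq_square power3_eq_cube algebra_simps)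
  show "euclidean_conformal_torsion g s = drift_det g s / (W s \<bullet> W s) powr (5/4)"
    by (simp add: euclidean_conformal_torsion_def det WW k_def \<tau>_def Let_def)
  show "euclidean_conformal_speed g s = root 4 (W s \<bullet> W s) * norm (vector_derivative g (at s))"
    by (simp add: euclidean_conformal_speed_def WW k_def \<tau>_def Let_def)
qed

lemma regular_curve_subset: "open J \<Longrightarrow> J \<subseteq> I \<Longrightarrow> regular_curve g J"
  using smooth_on_subset[OF smooth] regular by unfold_locales auto

text \<open>Nonvanishing of \<open>K\<close> is an open condition, so the curve can be restricted to
  a set where the Frenet frame is smooth.\<close>

lemma euclidean_conformal_formulas_at:
  assumes "s \<in> I" "K s \<noteq> 0"
  shows "euclidean_conformal_torsion g s = drift_det g s / (W s \<bullet> W s) powr (5/4)"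
    and "euclidean_conformal_speed g s = root 4 (W s \<bullet> W s) * norm (vector_derivative g (at s))"
proof -
  define J where "J = {x \<in> I. K x \<noteq> 0}"
  have "open (K -` (- {0}) \<inter> I)"
    using smooth_on_continuous[OF smooth_K] continuous_on_open_vimage[OF open_I] by blast
  moreover have "K -` (- {0}) \<inter> I = J" by (auto simp: J_def)
  ultimately interpret J: regular_curve g J
    by (intro regular_curve_subset) (auto simp: J_def)
  have J: "s \<in> J" "\<And>x. x \<in> J \<Longrightarrow> K x \<noteq> 0" using assms by (auto simp: J_def)
  show "euclidean_conformal_torsion g s = drift_det g s / (W s \<bullet> W s) powr (5/4)"
    "euclidean_conformal_speed g s = root 4 (W s \<bullet> W s) * norm (vector_derivative g (at s))"
    using J.euclidean_conformal_formulas[OF J] by simp_all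
qed

end

text \<open>Every Moebius sphere is the zero set of such a quadratic function; the base point \<open>p\<close>
  is redundant but makes the class visibly stable under Moebius transformations.\<close>

definition quadratic_contact :: "(real \<Rightarrow> real^3) \<Rightarrow> real \<Rightarrow> bool" where
  "quadratic_contact g s \<longleftrightarrow> (\<exists>x a b p. (x \<noteq> 0 \<or> a \<noteq> 0 \<or> b \<noteq> 0) \<and>
     vanishes_to_order 4 (\<lambda>r. x \<bullet> (g r - p) + a + b * ((g r - p) \<bullet> (g r - p))) s)"

text \<open>A zero triple product puts t, W and D W in one plane. Its normal \<nu> satisfies the
  conditions of \<open>order_four_contact\<close>; the case distinction covers dependent pairs of
  these vectors.\<close>

lemma (in regular_curve) drift_det_eq_0_imp_quadratic_contact:
  assumes s: "s \<in> I" and det: "drift_det g s = 0"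
  shows "quadratic_contact g s"
proof -
  have "t s \<noteq> 0" using inner_t_t[OF s] by auto
  have "\<exists>\<nu>. \<nu> \<noteq> 0 \<and> \<nu> \<bullet> t s = 0 \<and> \<nu> \<bullet> W s = 0 \<and> \<nu> \<bullet> D W s = 0"
  proof (cases "cross3 (t s) (W s) = 0")
    case False
    then show ?thesis
      using det by (intro exI[of _ "cross3 (t s) (W s)"]) (simp add: drift_det_def dot_cross_self inner_commute)
  next
    case True
    then have W: "W s = 0" using norm_and_cross_eq_0 inner_t_W[OF s] \<open>t s \<noteq> 0\<close> by blast
    show ?thesis
    proof (cases "cross3 (t s) (D W s) = 0")
      case False
      then show ?thesis
        using W by (intro exI[of _ "cross3 (t s) (D W s)"]) (simp add: dot_cross_self inner_commute)
    next
      case True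
      \<comment> \<open>Here W = 0 and D W is parallel to t, so any nonzero vector orthogonal to t
        serves.\<close>
      obtain e where e: "cross3 (t s) e \<noteq> 0" using cross_basis_nonzero[OF \<open>t s \<noteq> 0\<close>] by blast
      have "cross3 (t s) e \<bullet> D W s = - (cross3 (t s) (D W s) \<bullet> e)"
        by (simp add: cross3_simps)
      then show ?thesis
        using W e True by (intro exI[of _ "cross3 (t s) e"]) (simp add: dot_cross_self inner_commute)
    qed
  qed
  then obtain \<nu> where \<nu>: "\<nu> \<noteq> 0" "\<nu> \<bullet> t s = 0" "\<nu> \<bullet> W s = 0" "\<nu> \<bullet> D W s = 0" by blast
  show ?thesis
    unfolding quadratic_contact_def using order_four_contact[OF s \<nu>(2-4)] \<nu>(1)
    by (intro exI[of _ \<nu>] exI[of _ 0] exI[of _ "- (\<nu> \<bullet> K s / 2)"] exI[of _ "g s"]) simp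
qed

section \<open>Quadratic functions and the spheres they define\<close>

lemma C_diff_on_const: "C_diff_on n (\<lambda>_. c) U"
  by (induction n arbitrary: c) (auto simp: C_diff_on.simps)

lemma C_diff_on_affine: "C_diff_on n (\<lambda>p::'a::real_inner. y \<bullet> (p - q) + c) UNIV"
proof (cases n)
  case (Suc m)
  have "((\<lambda>p. y \<bullet> (p - q) + c) has_derivative (\<lambda>v. y \<bullet> v)) (at x)" for x
    by (auto intro!: derivative_eq_intros)
  then have "frechet_derivative (\<lambda>p. y \<bullet> (p - q) + c) (at x) = (\<lambda>v. y \<bullet> v)"
    "(\<lambda>p. y \<bullet> (p - q) + c) differentiable (at x)" for x
    by (metis frechet_derivative_at, blast intro: differentiableI)
  then show ?thesis by (simp add: Suc C_diff_on.simps C_diff_on_const)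
qed (auto simp: intro!: continuous_intros)

lemma has_derivative_quadratic:
  "((\<lambda>p::'a::real_inner. x \<bullet> (p - q) + a + b * ((p - q) \<bullet> (p - q))) has_derivative
     (\<lambda>v. (x + (2 * b) *\<^sub>R (p - q)) \<bullet> v)) (at p)"
  by (auto intro!: derivative_eq_intros simp: inner_simps inner_commute algebra_simps)

lemmas frechet_derivative_quadratic = frechet_derivative_at[OF has_derivative_quadratic, symmetric]

lemma smooth_on_quadratic:
  "smooth_on (\<lambda>p::'a::real_inner. x \<bullet> (p - q) + a + b * ((p - q) \<bullet> (p - q))) UNIV"
  unfolding smooth_on_def
proof
  fix n
  show "C_diff_on n (\<lambda>p::'a. x \<bullet> (p - q) + a + b * ((p - q) \<bullet> (p - q))) UNIV"
  proof (cases n)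
    case (Suc m)
    have "(x + (2 * b) *\<^sub>R (p - q)) \<bullet> v = ((2 * b) *\<^sub>R v) \<bullet> (p - q) + x \<bullet> v" for p v
      by (simp add: inner_simps inner_commute algebra_simps)
    then have "C_diff_on m (\<lambda>p. (x + (2 * b) *\<^sub>R (p - q)) \<bullet> v) UNIV" for v
      by (simp only: C_diff_on_affine)
    then show ?thesis
      using has_derivative_quadratic unfolding Suc C_diff_on.simps frechet_derivative_quadratic
      by (blast intro: differentiableI)
  qed (auto intro!: continuous_intros)
qed

text \<open>A nontrivial quadratic function may also have an empty zero set or a single point as
  zero set. The zero at \<open>\<gamma> s\<close> excludes the first, and second order vanishing
  along a regular curve excludes the second.\<close>

lemma quadratic_contact_imp_contact_sphere:
  assumes smooth: "smooth_on \<gamma> UNIV" and reg: "vector_derivative \<gamma> (at s) \<noteq> 0"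
    and "quadratic_contact \<gamma> s"
  shows "\<exists>S. moebius_sphere S \<and> contact_sphere 4 \<gamma> s S"
proof -
  obtain x a b q where nz: "x \<noteq> 0 \<or> a \<noteq> 0 \<or> b \<noteq> 0"
    and van: "vanishes_to_order 4 (\<lambda>r. x \<bullet> (\<gamma> r - q) + a + b * ((\<gamma> r - q) \<bullet> (\<gamma> r - q))) s"
    using assms(3) unfolding quadratic_contact_def by blast
  define F where "F p = x \<bullet> (p - q) + a + b * ((p - q) \<bullet> (p - q))" for p
  have van: "vanishes_to_order 4 (\<lambda>r. F (\<gamma> r)) s" using van by (simp add: F_def)
  then have F0: "F (\<gamma> s) = 0" by (auto simp: vanishes_to_order_def dest: spec[of _ 0])
  define S where "S = {p. F p = 0}"
  have contact: "contact_sphere 4 \<gamma> s S" if "\<And>p. F p = 0 \<Longrightarrow> x + (2 * b) *\<^sub>R (p - q) \<noteq> 0"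
  proof -
    have "frechet_derivative F (at p) = (\<lambda>v. (x + (2 * b) *\<^sub>R (p - q)) \<bullet> v)" for p
      unfolding F_def[abs_def] frechet_derivative_quadratic ..
    moreover have "(\<lambda>v. z \<bullet> v) \<noteq> (\<lambda>v. 0)" if "z \<noteq> 0" for z :: "real^3"
      using that inner_eq_zero_iff by metis
    ultimately have "local_defining_function F UNIV S"
      using that smooth_on_quadratic[of x q a b] unfolding local_defining_function_def S_def
      by (auto simp: F_def[abs_def])
    then show ?thesis
      using van unfolding contact_sphere_def vanishes_to_order_def
      by (intro exI[of _ F] exI[of _ UNIV]) (simp add: o_def)
  qed
  show ?thesis
  proof (cases "b = 0")
    case True
    have "x \<noteq> 0" using F0 nz True by (auto simp: F_def)
    moreover have "S = {p. x \<bullet> p = x \<bullet> q - a}"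
      by (auto simp: S_def F_def True inner_simps)
    ultimately have "moebius_sphere S" unfolding moebius_sphere_def by blast
    then show ?thesis using contact True \<open>x \<noteq> 0\<close> by auto
  next
    case False
    \<comment> \<open>Completing the square: \<open>c\<close> is the centre of the sphere.\<close>
    define c where "c = q - (1 / (2 * b)) *\<^sub>R x"
    have x: "x = (2 * b) *\<^sub>R (q - c)" using False by (simp add: c_def)
    have expand: "F p = b * ((p - c) \<bullet> (p - c)) + F c" for p
      unfolding F_def x by (simp add: inner_simps inner_commute algebra_simps)
    have Fc: "F c = - b * (norm (\<gamma> s - c))\<^sup>2" using expand[of "\<gamma> s"] F0 by (simp add: dot_square_norm)
    \<comment> \<open>For a sphere of radius zero, F = b |p - c|^2 has second derivative 2 b
      |\<gamma>'|^2 along the curve at \<open>s\<close>, which is nonzero.\<close>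
    have "\<gamma> s \<noteq> c"
    proof
      assume eq: "\<gamma> s = c"
      then have F: "F p = b * ((p - c) \<bullet> (p - c))" for p using expand[of p] Fc by simp
      note d = smooth_on_has_vector_derivative[OF open_UNIV smooth UNIV_I]
      note d' = smooth_on_has_vector_derivative[OF open_UNIV smooth_on_vector_derivative[OF open_UNIV smooth] UNIV_I]
      have dy: "((\<lambda>r. \<gamma> r - c) has_vector_derivative vector_derivative \<gamma> (at r)) (at r)" for r
        using has_vector_derivative_diff[OF d has_vector_derivative_const] by simp
      have "((\<lambda>r. b * ((\<gamma> r - c) \<bullet> (\<gamma> r - c))) has_vector_derivative
          b * (2 * ((\<gamma> r - c) \<bullet> vector_derivative \<gamma> (at r)))) (at r)" for r
        using has_vector_derivative_mult_right[OF bounded_bilinear.has_vector_derivative[OF bounded_bilinear_inner dy dy], of b r]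
        by (simp add: inner_commute)
      then have 1: "deriv (\<lambda>r. F (\<gamma> r)) = (\<lambda>r. b * (2 * ((\<gamma> r - c) \<bullet> vector_derivative \<gamma> (at r))))"
        unfolding F by (intro ext DERIV_imp_deriv) (simp add: has_real_derivative_iff_has_vector_derivative)
      have "((\<lambda>r. b * (2 * ((\<gamma> r - c) \<bullet> vector_derivative \<gamma> (at r)))) has_vector_derivative
          b * (2 * (vector_derivative \<gamma> (at s) \<bullet> vector_derivative \<gamma> (at s)))) (at s)"
        using has_vector_derivative_mult_right[OF has_vector_derivative_mult_right[OF bounded_bilinear.has_vector_derivative[OF bounded_bilinear_inner dy d']], of b 2 s]
        by (simp add: eq)
      then have "deriv (deriv (\<lambda>r. F (\<gamma> r))) s = b * (2 * (vector_derivative \<gamma> (at s) \<bullet> vector_derivative \<gamma> (at s)))"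
        unfolding 1 by (intro DERIV_imp_deriv) (simp add: has_real_derivative_iff_has_vector_derivative)
      moreover have "deriv (deriv (\<lambda>r. F (\<gamma> r))) s = 0"
        using van unfolding vanishes_to_order_def by (auto dest: spec[of _ 2] simp: numeral_2_eq_2)
      ultimately show False using False reg by simp
    qed
    have "F p = b * ((norm (p - c))\<^sup>2 - (norm (\<gamma> s - c))\<^sup>2)" for p
      using expand[of p] Fc by (simp add: dot_square_norm algebra_simps)
    then have S: "S = sphere c (norm (\<gamma> s - c))"
      using False by (auto simp: S_def dist_norm norm_minus_commute power2_eq_iff_nonneg)
    have "x + (2 * b) *\<^sub>R (p - q) \<noteq> 0" if "F p = 0" for p
    proof -
      have "p \<in> sphere c (norm (\<gamma> s - c))" using that S by (auto simp: S_def)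
      then have "p \<noteq> c" using \<open>\<gamma> s \<noteq> c\<close> by auto
      moreover have "x + (2 * b) *\<^sub>R (p - q) = (2 * b) *\<^sub>R (p - c)" by (simp add: x algebra_simps)
      ultimately show ?thesis using False by simp
    qed
    then have "contact_sphere 4 \<gamma> s S" by (rule contact)
    moreover have "moebius_sphere S"
      unfolding moebius_sphere_def S using \<open>\<gamma> s \<noteq> c\<close> by (intro disjI1 exI[of _ c] exI[of _ "norm (\<gamma> s - c)"]) simp
    ultimately show ?thesis by blast
  qed
qed

section \<open>Points of zero curvature\<close>

lemma inner_matrix_vector_mult: "x \<bullet> (A *v y) = (transpose A *v x) \<bullet> y" for A :: "real^'n^'m"
  by (metis dot_lmul_matrix vector_transpose_matrix transpose_transpose inner_commute)

lemma orthogonal_matrix_inner: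
  fixes A :: "real^'n^'n"
  assumes "orthogonal_matrix A"
  shows "(A *v y) \<bullet> (A *v z) = y \<bullet> z"
  using assms orthogonal_transformation_matrix[of "(*v) A"] by (simp add: orthogonal_transformation_def)

lemma orthogonal_matrix_transpose_mult_eq_0:
  fixes A :: "real^'n^'n"
  assumes "orthogonal_matrix A" "transpose A *v x = 0"
  shows "x = 0"
proof -
  have "A ** transpose A = mat 1" using assms(1) by (simp add: orthogonal_matrix_def)
  then have "x = A *v (transpose A *v x)" by (metis matrix_vector_mul_assoc matrix_vector_mul_lid)
  then show ?thesis using assms(2) by simp
qed

text \<open>A similarity pulls quadratic functions back to quadratic functions. For an inversion
  this holds after multiplication by the smooth factor |q - a|^2, which preserves the order of
  vanishing.\<close>

lemma quadratic_contact_moebius: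
  assumes smooth: "smooth_on \<gamma> UNIV" and \<phi>: "moebius_at (\<gamma> s) \<phi>"
    and sm\<phi>: "open I" "s \<in> I" "smooth_on (\<phi> \<circ> \<gamma>) I"
    and "quadratic_contact (\<phi> \<circ> \<gamma>) s"
  shows "quadratic_contact \<gamma> s"
proof -
  obtain x \<alpha> \<beta> p where nz: "x \<noteq> 0 \<or> \<alpha> \<noteq> 0 \<or> \<beta> \<noteq> 0"
    and van: "vanishes_to_order 4 (\<lambda>r. x \<bullet> (\<phi> (\<gamma> r) - p) + \<alpha> + \<beta> * ((\<phi> (\<gamma> r) - p) \<bullet> (\<phi> (\<gamma> r) - p))) s"
    using assms(6) unfolding quadratic_contact_def by auto
  obtain a b c A where c: "c > 0" and A: "orthogonal_matrix A" and
    cases: "\<phi> = (\<lambda>x. b + c *\<^sub>R (A *v (x - a))) \<or>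
      a \<noteq> \<gamma> s \<and> \<phi> = (\<lambda>x. b + (c / (norm (x - a))\<^sup>2) *\<^sub>R (A *v (x - a)))"
    using \<phi> unfolding moebius_at_def by blast
  define d where "d = b - p"
  define X where "X = c *\<^sub>R (transpose A *v (x + (2 * \<beta>) *\<^sub>R d))"
  define \<alpha>' where "\<alpha>' = x \<bullet> d + \<alpha> + \<beta> * (d \<bullet> d)"
  have X: "X \<bullet> y = c * (x \<bullet> (A *v y) + 2 * \<beta> * (d \<bullet> (A *v y)))" for y
    by (simp add: X_def inner_matrix_vector_mult matrix_vector_right_distrib inner_simps
        matrix_vector_mult_scaleR algebra_simps)
  have nz': "X \<noteq> 0 \<or> \<alpha>' \<noteq> 0 \<or> \<beta> \<noteq> 0"
  proof (rule ccontr)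
    assume "\<not> ?thesis"
    then have "\<beta> = 0" "\<alpha>' = 0" "transpose A *v x = 0" using c by (auto simp: X_def)
    moreover from this have "x = 0" using orthogonal_matrix_transpose_mult_eq_0[OF A] by blast
    ultimately show False using nz by (simp add: \<alpha>'_def)
  qed
  \<comment> \<open>The two orders correspond to the two cases: an inversion exchanges the constant
    coefficient with the quadratic one.\<close>
  have nz'': "X \<noteq> 0 \<or> c\<^sup>2 * \<beta> \<noteq> 0 \<or> \<alpha>' \<noteq> 0" "X \<noteq> 0 \<or> \<alpha>' \<noteq> 0 \<or> c\<^sup>2 * \<beta> \<noteq> 0"
    using nz' c by auto
  from cases show ?thesis
  proof
    assume eq: "\<phi> = (\<lambda>x. b + c *\<^sub>R (A *v (x - a)))"
    have "x \<bullet> (\<phi> q - p) + \<alpha> + \<beta> * ((\<phi> q - p) \<bullet> (\<phi> q - p))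
      = X \<bullet> (q - a) + \<alpha>' + (c\<^sup>2 * \<beta>) * ((q - a) \<bullet> (q - a))" for q
    proof -
      have "\<phi> q - p = d + c *\<^sub>R (A *v (q - a))" by (simp add: eq d_def)
      then show ?thesis
        using orthogonal_matrix_inner[OF A, of "q - a" "q - a"]
        by (simp add: X \<alpha>'_def inner_add_left inner_add_right inner_commute[of "A *v (q - a)" d]
            power2_eq_square distrib_left)
    qed
    with van have "vanishes_to_order 4 (\<lambda>r. X \<bullet> (\<gamma> r - a) + \<alpha>' + (c\<^sup>2 * \<beta>) * ((\<gamma> r - a) \<bullet> (\<gamma> r - a))) s"
      by simp
    then show ?thesis using nz''(2) unfolding quadratic_contact_def by blast
  next
    assume eq: "a \<noteq> \<gamma> s \<and> \<phi> = (\<lambda>x. b + (c / (norm (x - a))\<^sup>2) *\<^sub>R (A *v (x - a)))"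
    define J where "J = I \<inter> {r. \<gamma> r \<noteq> a}"
    have "continuous_on UNIV \<gamma>" by (rule smooth_on_continuous[OF smooth])
    then have "open {r. \<gamma> r \<noteq> a}" by (rule open_Collect_neq) (rule continuous_on_const)
    then have J: "open J" "s \<in> J" "smooth_on (\<phi> \<circ> \<gamma>) J" "smooth_on \<gamma> J"
      using sm\<phi> eq smooth_on_subset[OF sm\<phi>(3)] smooth_on_subset[OF smooth] by (auto simp: J_def)
    note intros = smooth_on_real_inner smooth_on_real_diff smooth_on_real_add smooth_on_real_mult
      smooth_on_real_const J J(3)[unfolded o_def]
    have "vanishes_to_order 4 (\<lambda>r. ((\<gamma> r - a) \<bullet> (\<gamma> r - a)) *
       (x \<bullet> (\<phi> (\<gamma> r) - p) + \<alpha> + \<beta> * ((\<phi> (\<gamma> r) - p) \<bullet> (\<phi> (\<gamma> r) - p)))) s"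
      by (rule vanishes_to_order_mult[OF J(1,2) _ _ van]) (intro intros)+
    moreover have "((q - a) \<bullet> (q - a)) * (x \<bullet> (\<phi> q - p) + \<alpha> + \<beta> * ((\<phi> q - p) \<bullet> (\<phi> q - p)))
      = X \<bullet> (q - a) + c\<^sup>2 * \<beta> + \<alpha>' * ((q - a) \<bullet> (q - a))" if "q \<noteq> a" for q
    proof -
      define n y where "n = (q - a) \<bullet> (q - a)" and "y = A *v (q - a)"
      have n: "n \<noteq> 0" using that by (simp add: n_def)
      have y: "y \<bullet> y = n" by (simp add: y_def n_def orthogonal_matrix_inner[OF A])
      have "\<phi> q - p = d + (c / n) *\<^sub>R y" using eq by (simp add: d_def y_def n_def dot_square_norm)
      then have "n * (x \<bullet> (\<phi> q - p) + \<alpha> + \<beta> * ((\<phi> q - p) \<bullet> (\<phi> q - p)))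
        = c * (x \<bullet> y + 2 * \<beta> * (d \<bullet> y)) + c\<^sup>2 * \<beta> + \<alpha>' * n"
        using n by (simp add: \<alpha>'_def inner_add_left inner_add_right inner_commute[of y d] y
            power2_eq_square field_simps)
      then show ?thesis by (simp add: X n_def y_def)
    qed
    ultimately have "vanishes_to_order 4 (\<lambda>r. X \<bullet> (\<gamma> r - a) + c\<^sup>2 * \<beta> + \<alpha>' * ((\<gamma> r - a) \<bullet> (\<gamma> r - a))) s"
      by (subst vanishes_to_order_cong[OF J(1,2), symmetric]) (auto simp: J_def)
    then show ?thesis using nz''(1) unfolding quadratic_contact_def by blast
  qed
qed

lemma moebius_smooth:
  fixes \<gamma> :: "real \<Rightarrow> real^3"
  assumes smooth: "smooth_on \<gamma> UNIV" and \<phi>: "moebius_at (\<gamma> s) \<phi>"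
  shows "\<exists>I. open I \<and> s \<in> I \<and> smooth_on (\<phi> \<circ> \<gamma>) I"
proof -
  obtain a b c A where
    cases: "\<phi> = (\<lambda>x. b + c *\<^sub>R (A *v (x - a))) \<or>
      a \<noteq> \<gamma> s \<and> \<phi> = (\<lambda>x. b + (c / (norm (x - a))\<^sup>2) *\<^sub>R (A *v (x - a)))"
    using \<phi> unfolding moebius_at_def by blast
  have lin: "bounded_linear ((*v) A)" by (rule matrix_vector_mul_bounded_linear)
  from cases show ?thesis
  proof
    assume eq: "\<phi> = (\<lambda>x. b + c *\<^sub>R (A *v (x - a)))"
    have "smooth_on (\<lambda>r. b + c *\<^sub>R (A *v (\<gamma> r - a))) UNIV"
      by (intro smooth_on_real_add smooth_on_real_scaleR smooth_on_bounded_linear[OF lin]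
          smooth_on_real_diff smooth_on_real_const open_UNIV smooth)
    then show ?thesis by (intro exI[of _ UNIV]) (simp add: eq o_def)
  next
    assume eq: "a \<noteq> \<gamma> s \<and> \<phi> = (\<lambda>x. b + (c / (norm (x - a))\<^sup>2) *\<^sub>R (A *v (x - a)))"
    define I where "I = {r. \<gamma> r \<noteq> a}"
    have "continuous_on UNIV \<gamma>" by (rule smooth_on_continuous[OF smooth])
    then have I: "open I" unfolding I_def by (rule open_Collect_neq) (rule continuous_on_const)
    have sm: "smooth_on \<gamma> I" by (rule smooth_on_subset[OF smooth]) simp
    have "smooth_on (\<lambda>r. b + (c * inverse ((\<gamma> r - a) \<bullet> (\<gamma> r - a))) *\<^sub>R (A *v (\<gamma> r - a))) I"
      by (intro smooth_on_real_add smooth_on_real_scaleR smooth_on_real_mult smooth_on_real_inverse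
          smooth_on_real_inner smooth_on_bounded_linear[OF lin] smooth_on_real_diff smooth_on_real_const I sm)
         (simp add: I_def)
    then have "smooth_on (\<phi> \<circ> \<gamma>) I" using eq by (simp add: o_def dot_square_norm field_simps)
    then show ?thesis using I eq by (intro exI[of _ I]) (auto simp: I_def)
  qed
qed

lemma regular_curve_near:
  fixes g :: "real \<Rightarrow> real^3"
  assumes sm: "open I" "s \<in> I" "smooth_on g I" and reg: "vector_derivative g (at s) \<noteq> 0"
  obtains J where "regular_curve g J" "s \<in> J"
proof
  define J where "J = {r \<in> I. vector_derivative g (at r) \<noteq> 0}"
  have "continuous_on I (\<lambda>r. vector_derivative g (at r))"
    by (intro smooth_on_continuous smooth_on_vector_derivative sm)
  then have "open ((\<lambda>r. vector_derivative g (at r)) -` (- {0}) \<inter> I)"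
    using continuous_on_open_vimage[OF sm(1)] by blast
  moreover have "(\<lambda>r. vector_derivative g (at r)) -` (- {0}) \<inter> I = J" by (auto simp: J_def)
  ultimately show "regular_curve g J"
    using smooth_on_subset[OF sm(3)] by unfold_locales (auto simp: J_def)
  show "s \<in> J" using sm(2) reg by (simp add: J_def)
qed

lemma curvature_eq_0_iff: "curvature g s = 0 \<longleftrightarrow> curvature_vector g s = 0"
  by (simp add: curvature_def curvature_vector_def)

lemma euclidean_conformal_torsion_neq_0:
  assumes sm: "open I" "s \<in> I" "smooth_on g I" and curv: "curvature g s \<noteq> 0"
    and nq: "\<not> quadratic_contact g s"
  shows "euclidean_conformal_torsion g s \<noteq> 0"
proof -
  have K: "curvature_vector g s \<noteq> 0" using curv by (simp add: curvature_eq_0_iff)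
  \<comment> \<open>At a singular point \<open>arc_deriv\<close> divides by zero and returns 0, so
    nonzero curvature forces regularity.\<close>
  then have "vector_derivative g (at s) \<noteq> 0" by (auto simp: curvature_vector_def arc_deriv_def)
  then obtain J where J: "regular_curve g J" and s: "s \<in> J" by (rule regular_curve_near[OF sm])
  interpret regular_curve g J by (rule J)
  have det: "drift_det g s \<noteq> 0" using drift_det_eq_0_imp_quadratic_contact[OF s] nq by blast
  then have "curvature_drift g s \<noteq> 0" by (auto simp: drift_det_def)
  then show ?thesis using det by (simp add: euclidean_conformal_formulas_at(1)[OF s K])
qed

text \<open>Differentiating g' = v t leaves only v' t, up to the speed, when K = 0. This turns zero
  curvature into a condition on parameter derivatives, which can be computed for an inverted
  curve.\<close>

lemma (in regular_curve) second_derivative_parallel: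
  assumes s: "s \<in> I" and K: "K s = 0"
  shows "\<exists>\<alpha>. ((\<lambda>r. vector_derivative g (at r)) has_vector_derivative \<alpha> *\<^sub>R vector_derivative g (at s)) (at s)"
proof -
  define v where "v r = norm (vector_derivative g (at r))" for r
  have v: "v r *\<^sub>R t r = vector_derivative g (at r)" if "r \<in> I" for r
    using regular[OF that] by (simp add: v_def unit_tangent_def arc_deriv_def)
  have "has_arc_deriv g (\<lambda>r. v r *\<^sub>R t r) (D v s *\<^sub>R t s) s"
    using has_arc_deriv_scaleR[OF has_arc_derivI[OF smooth_speed s] D_t[OF s]] K by (simp add: v_def[abs_def])
  then have "has_arc_deriv g (\<lambda>r. vector_derivative g (at r)) (D v s *\<^sub>R t s) s"
    using has_arc_deriv_cong[of "\<lambda>r. v r *\<^sub>R t r" "\<lambda>r. vector_derivative g (at r)", OF v _ s] by simp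
  then have "((\<lambda>r. vector_derivative g (at r)) has_vector_derivative D v s *\<^sub>R (v s *\<^sub>R t s)) (at s)"
    by (simp add: has_arc_deriv_def v_def mult.commute)
  then show ?thesis using v[OF s] by auto
qed

text \<open>Inversion in a point off the tangent line: the image of a point of zero curvature has
  nonzero curvature since the image of the tangent line is a circle.\<close>

lemma curvature_inversion_neq_0:
  fixes \<gamma> :: "real \<Rightarrow> real^3"
  assumes smooth: "smooth_on \<gamma> UNIV" and reg: "vector_derivative \<gamma> (at s) \<noteq> 0"
    and curv: "curvature \<gamma> s = 0"
  shows "\<exists>\<phi>. moebius_at (\<gamma> s) \<phi> \<and> curvature (\<phi> \<circ> \<gamma>) s \<noteq> 0"
proof -
  define \<gamma>' where "\<gamma>' r = vector_derivative \<gamma> (at r)" for r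
  have d: "(\<gamma> has_vector_derivative \<gamma>' r) (at r)" for r
    unfolding \<gamma>'_def by (rule smooth_on_has_vector_derivative[OF open_UNIV smooth UNIV_I])
  obtain J where J: "regular_curve \<gamma> J" "s \<in> J"
    by (rule regular_curve_near[OF open_UNIV UNIV_I smooth reg])
  obtain \<alpha> where d': "(\<gamma>' has_vector_derivative \<alpha> *\<^sub>R \<gamma>' s) (at s)"
    using regular_curve.second_derivative_parallel[OF J] curv
    unfolding \<gamma>'_def[abs_def] curvature_eq_0_iff by blast
  obtain n where n: "n \<noteq> 0" "n \<bullet> \<gamma>' s = 0"
    using cross_basis_nonzero[OF reg] dot_cross_self(4) unfolding \<gamma>'_def by blast
  define a where "a = \<gamma> s + n"
  \<comment> \<open>Minus the identity has determinant -1 in dimension three, so its composition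
    with the inversion preserves orientation.\<close>
  define A :: "real^3^3" where "A = mat (-1)"
  have Av: "A *v x = - x" for x
    by (simp add: A_def vec_eq_iff matrix_vector_mult_def mat_def forall_3 sum_3)
  define \<phi> where "\<phi> x = 0 + (1 / (norm (x - a))\<^sup>2) *\<^sub>R (A *v (x - a))" for x
  have "orthogonal_matrix A"
    by (simp add: A_def orthogonal_matrix_def matrix_matrix_mult_def transpose_def mat_def vec_eq_iff forall_3 sum_3)
  moreover have "det A = -1" by (simp add: A_def det_3 mat_def)
  ultimately have \<phi>: "moebius_at (\<gamma> s) \<phi>"
    unfolding moebius_at_def using n
    by (intro exI[of _ a] exI[of _ 0] exI[of _ 1] exI[of _ A]) (simp add: \<phi>_def[abs_def] a_def)
  define y where "y r = \<gamma> r - a" for r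
  define q where "q r = inverse (y r \<bullet> y r)" for r
  define U where "U = {r. \<gamma> r \<noteq> a}"
  have "continuous_on UNIV \<gamma>" by (rule smooth_on_continuous[OF smooth])
  then have U: "open U" unfolding U_def by (rule open_Collect_neq) (rule continuous_on_const)
  have sU: "s \<in> U" using n by (simp add: U_def a_def)
  have ys: "y s = - n" by (simp add: y_def a_def)
  have dy: "(y has_vector_derivative \<gamma>' r) (at r)" for r
    using has_vector_derivative_diff[OF d has_vector_derivative_const] by (simp add: y_def[abs_def])
  have dq: "(q has_real_derivative - (2 * (y r \<bullet> \<gamma>' r)) * (q r)\<^sup>2) (at r)" if "r \<in> U" for r
  proof -
    have "((\<lambda>r. y r \<bullet> y r) has_real_derivative 2 * (y r \<bullet> \<gamma>' r)) (at r)"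
      using bounded_bilinear.has_vector_derivative[OF bounded_bilinear_inner dy dy, of r]
      by (simp add: has_real_derivative_iff_has_vector_derivative inner_commute)
    moreover have "y r \<bullet> y r \<noteq> 0" using that by (simp add: U_def y_def)
    ultimately show ?thesis
      using DERIV_inverse_fun by (fastforce simp: q_def[abs_def] power2_eq_square)
  qed
  define \<psi>' where "\<psi>' r = (2 * (y r \<bullet> \<gamma>' r) * (q r)\<^sup>2) *\<^sub>R y r - q r *\<^sub>R \<gamma>' r" for r
  have d\<psi>: "(\<phi> \<circ> \<gamma> has_vector_derivative \<psi>' r) (at r)" if "r \<in> U" for r
  proof -
    have "((\<lambda>r. - (q r *\<^sub>R y r)) has_vector_derivative \<psi>' r) (at r)"
      using has_vector_derivative_minus[OF has_vector_derivative_scaleR[OF dq[OF that] dy]]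
      by (simp add: \<psi>'_def)
    moreover have "\<phi> \<circ> \<gamma> = (\<lambda>r. - (q r *\<^sub>R y r))"
      by (simp add: \<phi>_def[abs_def] o_def q_def y_def Av dot_square_norm divide_inverse
          flip: scaleR_minus_right)
    ultimately show ?thesis by simp
  qed
  have orth: "y s \<bullet> \<gamma>' s = 0" using n by (simp add: ys)
  have dyy: "((\<lambda>r. y r \<bullet> \<gamma>' r) has_real_derivative \<gamma>' s \<bullet> \<gamma>' s) (at s)"
    using bounded_bilinear.has_vector_derivative[OF bounded_bilinear_inner dy d'] orth
    by (simp add: has_real_derivative_iff_has_vector_derivative)
  have d\<psi>': "(\<psi>' has_vector_derivative
      (2 * (\<gamma>' s \<bullet> \<gamma>' s) * (q s)\<^sup>2) *\<^sub>R y s - q s *\<^sub>R (\<alpha> *\<^sub>R \<gamma>' s)) (at s)"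
    unfolding \<psi>'_def[abs_def]
    by (rule has_vector_derivative_eq_rhs)
       (auto intro!: derivative_eq_intros dyy dq sU dy d' simp: orth)
  have "curvature (\<phi> \<circ> \<gamma>) s \<noteq> 0"
  proof
    assume zero: "curvature (\<phi> \<circ> \<gamma>) s = 0"
    obtain I where I: "open I" "s \<in> I" "smooth_on (\<phi> \<circ> \<gamma>) I" using moebius_smooth[OF smooth \<phi>] by blast
    have qs: "q s > 0" using n by (simp add: q_def ys)
    have \<psi>'s: "\<psi>' s = - q s *\<^sub>R \<gamma>' s" by (simp add: \<psi>'_def orth)
    have vd: "vector_derivative (\<phi> \<circ> \<gamma>) (at r) = \<psi>' r" if "r \<in> U" for r
      by (rule vector_derivative_at[OF d\<psi>[OF that]])
    have "vector_derivative (\<phi> \<circ> \<gamma>) (at s) \<noteq> 0" using reg qs by (simp add: vd[OF sU] \<psi>'s \<gamma>'_def)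
    then obtain J where J: "regular_curve (\<phi> \<circ> \<gamma>) J" "s \<in> J" by (rule regular_curve_near[OF I])
    obtain \<beta> where "((\<lambda>r. vector_derivative (\<phi> \<circ> \<gamma>) (at r)) has_vector_derivative
        \<beta> *\<^sub>R vector_derivative (\<phi> \<circ> \<gamma>) (at s)) (at s)"
      using regular_curve.second_derivative_parallel[OF J] zero unfolding curvature_eq_0_iff by blast
    then have "(\<psi>' has_vector_derivative \<beta> *\<^sub>R \<psi>' s) (at s)"
      using has_vector_derivative_transform_within_open[OF _ U sU vd] vd[OF sU] by simp
    \<comment> \<open>Zero curvature would make the second derivative of the image parallel to its
      first, hence to \<gamma>'(s), which is orthogonal to \<open>y s\<close>. The computed second
      derivative has a nonzero component along \<open>y s\<close>.\<close>
    from vector_derivative_unique_at[OF this d\<psi>']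
    have "(\<beta> *\<^sub>R \<psi>' s) \<bullet> y s = ((2 * (\<gamma>' s \<bullet> \<gamma>' s) * (q s)\<^sup>2) *\<^sub>R y s - q s *\<^sub>R (\<alpha> *\<^sub>R \<gamma>' s)) \<bullet> y s"
      by simp
    then have "(\<gamma>' s \<bullet> \<gamma>' s) * (q s)\<^sup>2 * (y s \<bullet> y s) = 0"
      using orth by (simp add: \<psi>'s inner_simps inner_commute)
    then show False using reg qs n by (simp add: \<gamma>'_def ys)
  qed
  then show ?thesis using \<phi> by blast
qed

text \<open>What passes through the Moebius map is the absence of fourth order contact, so the
  conclusion holds for whichever map the choice operator selects.\<close>

lemma conformal_torsion_neq_0:
  fixes \<gamma> :: "real \<Rightarrow> real^3"
  assumes smooth: "smooth_on \<gamma> UNIV" and reg: "vector_derivative \<gamma> (at s) \<noteq> 0"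
    and nq: "\<not> quadratic_contact \<gamma> s"
  shows "conformal_torsion \<gamma> s \<noteq> 0"
proof (cases "curvature \<gamma> s = 0")
  case False
  then show ?thesis
    using euclidean_conformal_torsion_neq_0[OF open_UNIV UNIV_I smooth False nq]
    by (simp add: conformal_torsion_def normalized_curve_def)
next
  case True
  define \<phi> where "\<phi> = (SOME \<phi>. moebius_at (\<gamma> s) \<phi> \<and> curvature (\<phi> \<circ> \<gamma>) s \<noteq> 0)"
  have \<phi>: "moebius_at (\<gamma> s) \<phi>" "curvature (\<phi> \<circ> \<gamma>) s \<noteq> 0"
    using someI_ex[OF curvature_inversion_neq_0[OF smooth reg True]] unfolding \<phi>_def by blast+
  obtain I where I: "open I" "s \<in> I" "smooth_on (\<phi> \<circ> \<gamma>) I" using moebius_smooth[OF smooth \<phi>(1)] by blast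
  have "\<not> quadratic_contact (\<phi> \<circ> \<gamma>) s"
    using quadratic_contact_moebius[OF smooth \<phi>(1) I] nq by blast
  from euclidean_conformal_torsion_neq_0[OF I \<phi>(2) this]
  show ?thesis by (simp add: conformal_torsion_def normalized_curve_def True \<phi>_def)
qed

section \<open>The curve of osculating spheres\<close>

text \<open>The Lorentz form on \<open>\<real>\<^sup>5\<close> in light-cone coordinates: a point \<open>x\<close> is represented by the null
  vector \<open>(x, 1, x \<bullet> x)\<close>, an oriented sphere with centre \<open>c\<close> and radius \<open>r\<close> by
  \<open>(c, 1, c \<bullet> c - r\<^sup>2) / r\<close>.\<close>

definition lorentz :: "(real^3) \<times> real \<times> real \<Rightarrow> (real^3) \<times> real \<times> real \<Rightarrow> real" where
  "lorentz X Y = fst X \<bullet> fst Y - (fst (snd X) * snd (snd Y) + snd (snd X) * fst (snd Y)) / 2"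

lemma bounded_bilinear_lorentz: "bounded_bilinear lorentz"
  unfolding bilinear_conv_bounded_bilinear[symmetric] bilinear_def linear_iff lorentz_def
  by (auto simp: inner_simps algebra_simps add_divide_distrib)

lemma has_arc_deriv_Pair:
  "has_arc_deriv g f f' s \<Longrightarrow> has_arc_deriv g h h' s \<Longrightarrow> has_arc_deriv g (\<lambda>x. (f x, h x)) (f', h') s"
  unfolding has_arc_deriv_def by (simp add: has_vector_derivative_Pair)

definition lift_point :: "(real^3) \<Rightarrow> (real^3) \<times> real \<times> real" where
  "lift_point x = (x, 1, x \<bullet> x)"

text \<open>The oriented sphere with unit normal \<open>\<nu>\<close> at \<open>x\<close> and curvature \<open>c\<close>.\<close>

definition lift_sphere :: "real^3 \<Rightarrow> real^3 \<Rightarrow> real \<Rightarrow> (real^3) \<times> real \<times> real" where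
  "lift_sphere x \<nu> c = (\<nu>, 0, 2 * (x \<bullet> \<nu>)) + c *\<^sub>R lift_point x"

text \<open>Lifted points are null vectors, and two of them never pair positively: they lie in one
  half cone. Incidence of a point with a sphere becomes orthogonality.\<close>

lemma lorentz_lift:
  "lorentz (lift_point x) (lift_point y) = - (norm (x - y))\<^sup>2 / 2"
  "lorentz (lift_point x) (lift_sphere x \<nu> c) = 0"
  "lorentz (lift_sphere x \<nu> c) (lift_sphere x \<nu> c) = \<nu> \<bullet> \<nu>"
  by (simp_all add: lorentz_def lift_point_def lift_sphere_def inner_simps inner_commute field_simps
      power2_norm_eq_inner)

lemma continuous_nonzero_sign:
  fixes f :: "real \<Rightarrow> real"
  assumes "continuous_on UNIV f" "\<And>s. f s \<noteq> 0"
  obtains e where "e = 1 \<or> e = -1" "\<And>s. e * f s > 0"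
proof -
  have "connected (range f)" by (rule connected_continuous_image[OF assms(1)]) simp
  then have "f a < 0 \<Longrightarrow> f b < 0" for a b
    using connectedD_interval[of "range f" "f a" "f b" 0] assms(2) by (force simp: not_less)
  then consider "\<forall>s. f s < 0" | "\<forall>s. f s > 0" using assms(2) by (metis linorder_neqE_linordered_idom)
  then show ?thesis using that[of 1] that[of "-1"] by cases auto
qed

lemma vector_derivative_periodic:
  fixes f :: "real \<Rightarrow> 'a::real_normed_vector"
  assumes "f differentiable (at (s + L))" "\<And>s. f (s + L) = f s"
  shows "vector_derivative f (at (s + L)) = vector_derivative f (at s)"
proof -
  have "(f has_vector_derivative vector_derivative f (at (s + L))) (at (s + L))"
    using assms(1) vector_derivative_works by blast
  moreover have "((\<lambda>x. x + L) has_vector_derivative 1) (at s)"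
    by (auto intro!: derivative_eq_intros)
  ultimately have "((f \<circ> (\<lambda>x. x + L)) has_vector_derivative 1 *\<^sub>R vector_derivative f (at (s + L))) (at s)"
    by (intro vector_diff_chain_at) auto
  then show ?thesis using assms(2) by (simp add: o_def vector_derivative_at)
qed

section \<open>The frame carried by the drift and its Lorentz lift\<close>

locale closed_sphere_curve = regular_curve g UNIV for g +
  fixes L :: real
  assumes L: "L > 0" and periodic: "\<And>s. g (s + L) = g s" and det: "\<And>s. drift_det g s \<noteq> 0"
begin

lemma arc_deriv_periodic:
  assumes "smooth_on f UNIV" "\<And>s. f (s + L) = f s"
  shows "D f (s + L) = D f s"
proof -
  have "vector_derivative h (at (s + L)) = vector_derivative h (at s)"
    if "smooth_on h UNIV" "\<And>s. h (s + L) = h s" for h :: "real \<Rightarrow> 'c::real_normed_vector"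
    using smooth_on_has_vector_derivative[OF open_UNIV that(1) UNIV_I] that(2)
    by (intro vector_derivative_periodic) (auto simp: has_vector_derivative_def differentiable_def)
  note this[OF assms]
  moreover have "vector_derivative g (at (s + L)) = vector_derivative g (at s)"
    using smooth_on_has_vector_derivative[OF open_UNIV smooth UNIV_I] periodic
    by (intro vector_derivative_periodic) (auto simp: has_vector_derivative_def differentiable_def)
  ultimately show ?thesis by (simp add: arc_deriv_def)
qed

lemma W_neq_0: "W s \<noteq> 0"
  using det[of s] by (auto simp: drift_det_def)

text \<open>Angular velocity of W in the normal bundle per unit of Euclidean arc-length, as
  \<open>D_P_Q\<close> confirms. Multiplied by the speed it becomes T dt, without fractional powers
  and also at zero curvature.\<close>

definition rate :: "real \<Rightarrow> real" where
  "rate s = drift_det g s / (W s \<bullet> W s)"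

text \<open>\<open>P\<close> takes the place of the principal normal. \<open>Q\<close> is normal to
  the osculating sphere, since Q \<bullet> W = 0 is the third order contact condition.\<close>

definition P :: "real \<Rightarrow> real^3" where "P s = inverse (norm (W s)) *\<^sub>R W s"
definition Q :: "real \<Rightarrow> real^3" where "Q s = cross3 (t s) (P s)"

lemma smooth_P: "smooth_on P UNIV"
  unfolding P_def[abs_def]
  by (intro smooth_on_real_scaleR smooth_on_real_inverse smooth_on_real_norm smooth_W open_UNIV)
     (simp_all add: W_neq_0)

lemma smooth_Q: "smooth_on Q UNIV"
  unfolding Q_def[abs_def] by (intro smooth_on_real_cross3 smooth_t smooth_P open_UNIV)

lemma smooth_rate: "smooth_on rate UNIV"
  unfolding rate_def[abs_def] drift_det_def divide_inverse
  by (intro smooth_on_real_mult smooth_on_real_inverse smooth_on_real_inner smooth_on_real_cross3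
      smooth_t smooth_W smooth_arc_deriv open_UNIV) (simp add: W_neq_0)

lemma W_eq: "W s = norm (W s) *\<^sub>R P s"
  by (simp add: P_def W_neq_0)

lemma frame: "t s \<bullet> t s = 1" "P s \<bullet> P s = 1" "t s \<bullet> P s = 0" "t s \<bullet> Q s = 0" "P s \<bullet> Q s = 0" "Q s \<bullet> Q s = 1"
proof -
  show tt: "t s \<bullet> t s = 1" by (simp add: inner_t_t)
  show PP: "P s \<bullet> P s = 1" using W_neq_0[of s] by (simp add: P_def dot_square_norm power2_eq_square)
  show tP: "t s \<bullet> P s = 0" by (simp add: P_def inner_t_W)
  show "t s \<bullet> Q s = 0" "P s \<bullet> Q s = 0" by (simp_all add: Q_def dot_cross_self)
  show "Q s \<bullet> Q s = 1" using tt PP tP by (simp add: Q_def dot_cross)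
qed

lemma D_P_Q: "D P s \<bullet> Q s = rate s"
proof -
  note DP = has_arc_derivI[OF smooth_P UNIV_I]
  have "has_arc_deriv g (\<lambda>s. norm (W s)) (D (\<lambda>s. norm (W s)) s) s"
    by (intro has_arc_derivI UNIV_I smooth_on_real_norm smooth_W open_UNIV W_neq_0)
  from has_arc_deriv_scaleR[OF this DP]
  have "has_arc_deriv g W (D (\<lambda>s. norm (W s)) s *\<^sub>R P s + norm (W s) *\<^sub>R D P s) s"
    by (simp add: W_eq[symmetric])
  then have "D W s = D (\<lambda>s. norm (W s)) s *\<^sub>R P s + norm (W s) *\<^sub>R D P s"
    by (rule arc_deriv_eq) simp
  moreover have "cross3 (t s) (W s) = norm (W s) *\<^sub>R Q s"
    by (subst W_eq) (simp add: Q_def cross_mult_right)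
  ultimately have "drift_det g s = (norm (W s))\<^sup>2 * (D P s \<bullet> Q s)"
    using frame[of s] by (simp add: drift_det_def inner_simps inner_commute power2_eq_square)
  then show ?thesis using W_neq_0[of s] by (simp add: rate_def dot_square_norm)
qed

lemma D_P: "has_arc_deriv g P (- (K s \<bullet> P s) *\<^sub>R t s + rate s *\<^sub>R Q s) s"
proof -
  note DP = has_arc_derivI[OF smooth_P UNIV_I, of s]
  have "D P s \<bullet> P s = 0"
    using has_arc_deriv_constant[OF frame(2) has_arc_deriv_inner[OF DP DP]] by (simp add: inner_commute)
  moreover have "D P s \<bullet> t s = - (K s \<bullet> P s)"
    using has_arc_deriv_constant[OF frame(3) has_arc_deriv_inner[OF D_t DP]] by (simp add: inner_commute)
  ultimately show ?thesis
    using DP D_P_Q[of s] orthonormal_expansion[OF frame(1,2,3), of "D P s" s] by (simp add: Q_def)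
qed

lemma D_Q: "has_arc_deriv g Q (- (K s \<bullet> Q s) *\<^sub>R t s - rate s *\<^sub>R P s) s"
proof -
  note DP = has_arc_derivI[OF smooth_P UNIV_I, of s] and DQ = has_arc_derivI[OF smooth_Q UNIV_I, of s]
  have "D Q s \<bullet> Q s = 0"
    using has_arc_deriv_constant[OF frame(6) has_arc_deriv_inner[OF DQ DQ]] by (simp add: inner_commute)
  moreover have "D Q s \<bullet> t s = - (K s \<bullet> Q s)"
    using has_arc_deriv_constant[OF frame(4) has_arc_deriv_inner[OF D_t DQ]] by (simp add: inner_commute)
  moreover have "D Q s \<bullet> P s = - rate s"
    using has_arc_deriv_constant[OF frame(5) has_arc_deriv_inner[OF DP DQ]] D_P_Q[of s] by (simp add: inner_commute)
  ultimately show ?thesis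
    using DQ orthonormal_expansion[OF frame(1,2,3), of "D Q s" s] Q_def[of s] by simp
qed

text \<open>The curvature K \<bullet> \<nu> is exactly what cancels the tangential part of \<nu>'.
  What remains is the rotation of the normal and a multiple of the null vector of the point.\<close>

lemma D_lift_sphere:
  assumes \<nu>: "has_arc_deriv g \<nu> (- (K s \<bullet> \<nu> s) *\<^sub>R t s + c *\<^sub>R \<mu>) s" and orth: "t s \<bullet> \<nu> s = 0"
  shows "has_arc_deriv g (\<lambda>s. lift_sphere (g s) (\<nu> s) (K s \<bullet> \<nu> s))
    (c *\<^sub>R lift_sphere (g s) \<mu> (K s \<bullet> \<mu>) + (W s \<bullet> \<nu> s) *\<^sub>R lift_point (g s)) s"
proof -
  note g = D_g[OF UNIV_I, of s] and K = D_K[OF UNIV_I, of s]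
  have "has_arc_deriv g (\<lambda>s. (\<nu> s, 0, 2 * (g s \<bullet> \<nu> s)) + (K s \<bullet> \<nu> s) *\<^sub>R (g s, 1::real, g s \<bullet> g s))
    ((- (K s \<bullet> \<nu> s) *\<^sub>R t s + c *\<^sub>R \<mu>, 0,
        0 * (g s \<bullet> \<nu> s) + 2 * (t s \<bullet> \<nu> s + g s \<bullet> (- (K s \<bullet> \<nu> s) *\<^sub>R t s + c *\<^sub>R \<mu>)))
     + (((W s - (K s \<bullet> K s) *\<^sub>R t s) \<bullet> \<nu> s + K s \<bullet> (- (K s \<bullet> \<nu> s) *\<^sub>R t s + c *\<^sub>R \<mu>)) *\<^sub>R (g s, 1::real, g s \<bullet> g s)
      + (K s \<bullet> \<nu> s) *\<^sub>R (t s, 0, t s \<bullet> g s + g s \<bullet> t s))) s"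
    by (intro has_arc_deriv_intros has_arc_deriv_Pair g K \<nu>)
  moreover have "K s \<bullet> t s = 0" using inner_t_K[of s] by (simp add: inner_commute)
  ultimately show ?thesis
    using orth by (simp add: lift_sphere_def lift_point_def inner_simps inner_commute[of "t s" "g s"] algebra_simps)
qed

lemma total_rate:
  assumes e: "e = 1 \<or> e = -1" "\<And>s. e * rate s > 0"
  shows "integral {0..L} (\<lambda>s. \<bar>rate s\<bar> * norm (vector_derivative g (at s))) \<ge> 2 * pi"
proof -
  define v where "v s = norm (vector_derivative g (at s))" for s
  have v: "v s > 0" for s using regular[of s] by (simp add: v_def)
  have smooth_v: "smooth_on v UNIV" using smooth_speed by (simp add: v_def[abs_def])
  have abs_rate: "\<bar>rate s\<bar> = e * rate s" for s using e(1) e(2)[of s] by auto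
  \<comment> \<open>\<sigma> lifts the osculating sphere: as W \<bullet> Q = 0, its derivative has
    no component along the lifted point. The sign in \<epsilon> makes the angular speed e * rate
    positive. All \<open>M s\<close> are multiples of lifted points with the common sign -e, hence
    lie in the same half cone.\<close>
  define \<sigma> where "\<sigma> s = lift_sphere (g s) (Q s) (K s \<bullet> Q s)" for s
  define \<epsilon> where "\<epsilon> s = - e *\<^sub>R lift_sphere (g s) (P s) (K s \<bullet> P s)" for s
  define M where "M s = (- e * norm (W s) * v s) *\<^sub>R lift_point (g s)" for s
  have ee: "e * e = 1" "e * (e * x) = x" for x using e(1) by auto
  have WP: "W s \<bullet> P s = norm (W s)" "W s \<bullet> Q s = 0" for s
    using frame(2)[of s] frame(5)[of s] by (subst W_eq, simp)+
  have per_t: "t (s + L) = t s" for s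
    unfolding unit_tangent_def by (rule arc_deriv_periodic[OF smooth periodic])
  have per_K: "K (s + L) = K s" for s
    unfolding curvature_vector_def by (rule arc_deriv_periodic[OF smooth_t per_t])
  have per_W: "W (s + L) = W s" for s
    unfolding curvature_drift_def by (simp add: arc_deriv_periodic[OF smooth_K per_K] per_K per_t)
  have per_P: "P (s + L) = P s" and per_Q: "Q (s + L) = Q s" for s
    by (simp_all add: P_def Q_def per_W per_t)
  note per = periodic[of 0] per_K[of 0] per_P[of 0] per_Q[of 0]
  have "integral {0..L} (\<lambda>s. \<bar>rate s\<bar> * v s) \<ge> 2 * pi"
  proof (rule closed_null_curve_length[OF bounded_bilinear_lorentz L, where \<sigma> = \<sigma> and \<epsilon> = \<epsilon> and M = M])
    show "continuous_on UNIV (\<lambda>s. \<bar>rate s\<bar> * v s)"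
      by (intro continuous_intros smooth_on_continuous smooth_rate smooth_v)
    show "\<bar>rate s\<bar> * v s > 0" for s using e(2)[of s] v[of s] by (auto simp: abs_rate)
    have "has_arc_deriv g Q (- (K s \<bullet> Q s) *\<^sub>R t s + (- rate s) *\<^sub>R P s) s" for s
      using D_Q[of s] by simp
    from D_lift_sphere[OF this frame(4)]
    have "has_arc_deriv g \<sigma> (- rate s *\<^sub>R lift_sphere (g s) (P s) (K s \<bullet> P s)) s" for s
      by (simp add: \<sigma>_def[abs_def] WP)
    then show "(\<sigma> has_vector_derivative (\<bar>rate s\<bar> * v s) *\<^sub>R \<epsilon> s) (at s)" for s
      unfolding abs_rate by (simp add: has_arc_deriv_def v_def \<epsilon>_def mult_ac ee)
    have "has_arc_deriv g \<epsilon> (0 *\<^sub>R lift_sphere (g s) (P s) (K s \<bullet> P s) +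
        (- e) *\<^sub>R (rate s *\<^sub>R \<sigma> s + norm (W s) *\<^sub>R lift_point (g s))) s" for s
      using has_arc_deriv_scaleR[OF has_arc_deriv_const[of g "- e"] D_lift_sphere[OF D_P frame(3)], of s]
      unfolding \<sigma>_def \<epsilon>_def[abs_def] WP by (simp add: add.commute)
    then show "(\<epsilon> has_vector_derivative M s - (\<bar>rate s\<bar> * v s) *\<^sub>R \<sigma> s) (at s)" for s
      unfolding abs_rate has_arc_deriv_def by (rule has_vector_derivative_eq_rhs) (simp add: v_def M_def algebra_simps)
    show "\<sigma> L = \<sigma> 0" "\<epsilon> L = \<epsilon> 0" using per by (simp_all add: \<sigma>_def \<epsilon>_def)
    interpret h: bounded_bilinear lorentz by (rule bounded_bilinear_lorentz)
    show "lorentz (\<sigma> s) (\<sigma> s) = 1" for s by (simp add: \<sigma>_def lorentz_lift frame)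
    show "lorentz (M s) (\<sigma> s) = 0" for s by (simp add: \<sigma>_def M_def h.scaleR_left h.minus_left lorentz_lift)
    show "lorentz (M s) (M r) \<le> 0" for s r
    proof -
      have "lorentz (M s) (M r) = - (e * e * (norm (W s) * v s * (norm (W r) * v r) * ((norm (g s - g r))\<^sup>2 / 2)))"
        by (simp add: M_def h.scaleR_left h.scaleR_right h.minus_left h.minus_right lorentz_lift mult_ac)
      then show ?thesis using v[of s] v[of r] by (simp add: ee)
    qed
  qed
  then show ?thesis by (simp add: v_def)
qed

section \<open>From the rotation rate to the conformal torsion\<close>

text \<open>At a zero of K its arc-length derivative is W, which is nonzero, so zeros are isolated;
  compactness of {0..L} does the rest.\<close>

lemma finite_zero_curvature: "finite {s \<in> {0..L}. K s = 0}"
proof (rule ccontr)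
  define Z where "Z = {s \<in> {0..L}. K s = 0}"
  assume "infinite {s \<in> {0..L}. K s = 0}"
  then have "infinite Z" unfolding Z_def .
  then obtain x where x: "x \<in> {0..L}" "x islimpt Z"
    using Heine_Borel_imp_Bolzano_Weierstrass[of "{0..L}" Z] unfolding Z_def by blast
  have contK: "continuous_on UNIV K" by (rule smooth_on_continuous[OF smooth_K])
  have "closed {s. K s = 0}" by (rule closed_Collect_eq[OF contK continuous_on_const])
  then have "K x = 0" using islimpt_subset[OF x(2), of "{s. K s = 0}"] closed_limpt by (auto simp: Z_def)
  \<comment> \<open>Projecting K on the fixed vector \<open>W x\<close> gives a real function with
    positive derivative at the accumulation point, hence without other zeros nearby.\<close>
  then have "has_arc_deriv g (\<lambda>s. W x \<bullet> K s) (W x \<bullet> W x) x"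
    using has_arc_deriv_inner[OF has_arc_deriv_const[of g "W x"] D_K[OF UNIV_I], of x] by simp
  then have d: "((\<lambda>s. W x \<bullet> K s) has_real_derivative norm (vector_derivative g (at x)) * (W x \<bullet> W x)) (at x)"
    by (simp add: has_arc_deriv_def has_real_derivative_iff_has_vector_derivative)
  have pos: "norm (vector_derivative g (at x)) * (W x \<bullet> W x) > 0"
    using regular[of x] W_neq_0[of x] by simp
  obtain d1 where d1: "d1 > 0" "\<And>h. 0 < h \<Longrightarrow> h < d1 \<Longrightarrow> W x \<bullet> K x < W x \<bullet> K (x + h)"
    using DERIV_pos_inc_right[OF d pos] by blast
  obtain d2 where d2: "d2 > 0" "\<And>h. 0 < h \<Longrightarrow> h < d2 \<Longrightarrow> W x \<bullet> K (x - h) < W x \<bullet> K x"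
    using DERIV_pos_inc_left[OF d pos] by blast
  obtain y where y: "y \<in> Z" "y \<noteq> x" "dist y x < min d1 d2"
    using x(2) d1(1) d2(1) unfolding islimpt_approachable by (metis min_less_iff_conj)
  then show False
    using d1(2)[of "y - x"] d2(2)[of "x - y"] \<open>K x = 0\<close> by (cases "x < y") (auto simp: Z_def dist_real_def)
qed

lemma conformal_torsion_speed:
  assumes "K s \<noteq> 0"
  shows "conformal_torsion g s * conformal_speed g s = rate s * norm (vector_derivative g (at s))"
    "conformal_speed g s \<ge> 0"
proof -
  have c: "curvature g s \<noteq> 0" using assms by (simp add: curvature_eq_0_iff)
  have R: "W s \<bullet> W s > 0" by (simp add: W_neq_0)
  \<comment> \<open>The power 1/4 cancels against the fourth root in the conformal speed, leaving
    the denominator of \<open>rate\<close>.\<close>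
  have "(W s \<bullet> W s) powr (5/4) = (W s \<bullet> W s) powr (1 + 1/4)" by simp
  also have "\<dots> = (W s \<bullet> W s) * (W s \<bullet> W s) powr (1/4)" using R by (subst powr_add) simp
  also have "(W s \<bullet> W s) powr (1/4) = root 4 (W s \<bullet> W s)" using R by (simp add: root_powr_inverse)
  finally have *: "(W s \<bullet> W s) powr (5/4) = (W s \<bullet> W s) * root 4 (W s \<bullet> W s)" .
  have "root 4 (W s \<bullet> W s) > 0" using R by simp
  then show "conformal_torsion g s * conformal_speed g s = rate s * norm (vector_derivative g (at s))"
    using euclidean_conformal_formulas_at[OF UNIV_I assms] c
    by (simp add: conformal_torsion_def conformal_speed_def normalized_curve_def rate_def *)
  show "conformal_speed g s \<ge> 0"
    using euclidean_conformal_formulas_at[OF UNIV_I assms] c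
    by (simp add: conformal_speed_def normalized_curve_def)
qed

text \<open>The values chosen at the finitely many points of zero curvature do not affect the
  integrals. Elsewhere T dt is a constant sign times the integrand of \<open>total_rate\<close>, so
  the absolute value passes through the integral.\<close>

lemma total_conformal_torsion:
  "integral {0..L} (\<lambda>s. \<bar>conformal_torsion g s\<bar> * conformal_speed g s)
     = \<bar>integral {0..L} (\<lambda>s. conformal_torsion g s * conformal_speed g s)\<bar>"
  "\<bar>integral {0..L} (\<lambda>s. conformal_torsion g s * conformal_speed g s)\<bar> \<ge> 2 * pi"
proof -
  define Z where "Z = {s \<in> {0..L}. K s = 0}"
  have Z: "negligible Z" using finite_zero_curvature by (simp add: Z_def negligible_finite)
  have "rate s \<noteq> 0" for s using det[of s] W_neq_0[of s] by (simp add: rate_def)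
  then obtain e where e: "e = 1 \<or> e = -1" "\<And>s. e * rate s > 0"
    using continuous_nonzero_sign[OF smooth_on_continuous[OF smooth_rate]] by blast
  define c where "c s = \<bar>rate s\<bar> * norm (vector_derivative g (at s))" for s
  have rate: "rate s = e * \<bar>rate s\<bar>" for s using e(1) e(2)[of s] by auto
  have T: "conformal_torsion g s * conformal_speed g s = e * c s"
    "\<bar>conformal_torsion g s\<bar> * conformal_speed g s = c s" if "s \<in> {0..L} - Z" for s
  proof -
    have K: "K s \<noteq> 0" using that by (simp add: Z_def)
    show "conformal_torsion g s * conformal_speed g s = e * c s"
      using conformal_torsion_speed(1)[OF K] rate[of s] by (simp add: c_def)
    have "\<bar>conformal_torsion g s\<bar> * conformal_speed g s = \<bar>conformal_torsion g s * conformal_speed g s\<bar>"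
      using conformal_torsion_speed(2)[OF K] by (simp add: abs_mult)
    then show "\<bar>conformal_torsion g s\<bar> * conformal_speed g s = c s"
      unfolding conformal_torsion_speed(1)[OF K] by (simp add: c_def abs_mult)
  qed
  have 1: "integral {0..L} (\<lambda>s. conformal_torsion g s * conformal_speed g s) = e * integral {0..L} c"
    using integral_spike[OF Z, of "{0..L}" "\<lambda>s. conformal_torsion g s * conformal_speed g s" "\<lambda>s. e * c s"] T(1) by simp
  have 2: "integral {0..L} (\<lambda>s. \<bar>conformal_torsion g s\<bar> * conformal_speed g s) = integral {0..L} c"
    using integral_spike[OF Z, of "{0..L}" "\<lambda>s. \<bar>conformal_torsion g s\<bar> * conformal_speed g s" c] T(2) by simp
  have 3: "integral {0..L} c \<ge> 2 * pi" using total_rate[OF e] by (simp add: c_def[abs_def])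
  then have "integral {0..L} c \<ge> 0" using pi_ge_zero by linarith
  then have "\<bar>e * integral {0..L} c\<bar> = integral {0..L} c" using e(1) by (auto simp: abs_mult)
  then show "integral {0..L} (\<lambda>s. \<bar>conformal_torsion g s\<bar> * conformal_speed g s)
     = \<bar>integral {0..L} (\<lambda>s. conformal_torsion g s * conformal_speed g s)\<bar>"
    "\<bar>integral {0..L} (\<lambda>s. conformal_torsion g s * conformal_speed g s)\<bar> \<ge> 2 * pi"
    using 1 2 3 by simp_all
qed

end

theorem corollary16:
  fixes \<gamma> :: "real \<Rightarrow> real^3" and L :: real
  assumes "closed_curve \<gamma> L"
    and "vertex_free \<gamma>"
    and "\<And>s S k. moebius_sphere S \<Longrightarrow> k \<ge> 4 \<Longrightarrow> \<not> contact_sphere k \<gamma> s S"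
  shows "(\<forall>s. conformal_torsion \<gamma> s \<noteq> 0) \<and>
    integral {0..L} (\<lambda>s. \<bar>conformal_torsion \<gamma> s\<bar> * conformal_speed \<gamma> s)
      = \<bar>integral {0..L} (\<lambda>s. conformal_torsion \<gamma> s * conformal_speed \<gamma> s)\<bar> \<and>
    \<bar>integral {0..L} (\<lambda>s. conformal_torsion \<gamma> s * conformal_speed \<gamma> s)\<bar> \<ge> 2 * pi"
proof -
  have L: "L > 0" and smooth: "smooth_on \<gamma> UNIV" and reg: "\<And>s. vector_derivative \<gamma> (at s) \<noteq> 0"
    and per: "\<And>s. \<gamma> (s + L) = \<gamma> s"
    using assms(1) by (auto simp: closed_curve_def)
  have nq: "\<not> quadratic_contact \<gamma> s" for s
    using quadratic_contact_imp_contact_sphere[OF smooth reg] assms(3) by blast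
  interpret regular_curve \<gamma> UNIV by unfold_locales (auto simp: smooth reg)
  interpret closed_sphere_curve \<gamma> L
    by unfold_locales (use L per nq drift_det_eq_0_imp_quadratic_contact in auto)
  show ?thesis
    using conformal_torsion_neq_0[OF smooth reg nq] total_conformal_torsion by blast
qed

end
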